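(* Let $\Omega\subset\mathbb{C}^n$ be a bounded domain and let $\mathcal{R}$ be a quasi-free Hilbert module over $A(\Omega)$ which is semi-Fredholm at every point of $\Omega$. If $\mathcal{R}$ has a pure isometrically isomorphic submodule of finite codimension in $\mathcal{R}$, then $n=1$.
   Context: For a bounded domain $\Omega\subset\mathbb{C}^n$, $A(\Omega)$ is the completion, in the supremum norm over $\Omega$, of the functions holomorphic on a neighborhood of the closure of $\Omega$. All Hilbert spaces are complex and separable. A (contractive) Hilbert module over $A(\Omega)$ is a Hilbert space $\mathcal{M}$ which is a unital $A(\Omega)$-module with $\|\varphi f\|_{\mathcal{M}}\le\|\varphi\|_{A(\Omega)}\|f\|_{\mathcal{M}}$ for $\varphi\in A(\Omega)$, $f\in\mathcal{M}$. Submodules are closed. Quasi-free: for $1\le m\le\infty$, let $\ell^2_m$ be the Hilbert space of dimension $m$ ($\ell^2$ if $m=\infty$). A Hilbert space $\mathcal{R}$ is a quasi-free Hilbert module of rank $m$ over $A(\Omega)$ if it is the completion of the algebraic tensor product $A(\Omega)\otimes\ell^2_m$ in an inner product such that: (1) for each $\pmb{z}\in\Omega$ the evaluation map $\mathrm{eval}_{\pmb z}:A(\Omega)\otimes\ell^2_m\to\ell^2_m$ is bounded, and these maps are locally uniformly bounded on $\Omega$; (2) $\|\sum\varphi\theta_i\otimes x_i\|_{\mathcal{R}}\le\|\varphi\|_{A(\Omega)}\|\sum\theta_i\otimes x_i\|_{\mathcal{R}}$ for $\varphi,\theta_i\in A(\Omega)$, $x_i\in\ell^2_m$; (3) for every sequence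 $\{F_i\}$ in $A(\Omega)\otimes\ell^2_m$ which is Cauchy in the $\mathcal{R}$-norm, $\mathrm{eval}_{\pmb z}(F_i)\to0$ for all $\pmb z\in\Omega$ if and only if $\|F_i\|_{\mathcal{R}}\to0$. A quasi-free Hilbert module is one that is quasi-free of some rank $m$, $1\le m\le\infty$. Semi-Fredholm: for $\pmb\omega_0\in\Omega$, let $I_{\pmb\omega_0}\subset\mathbb{C}[z_1,\dots,z_n]$ be the maximal ideal of polynomials vanishing at $\pmb\omega_0$. A Hilbert module $\mathcal{M}$ is semi-Fredholm at $\pmb\omega_0$ if $\dim\mathcal{M}/(I_{\pmb\omega_0}\cdot\mathcal{M})<\infty$, where $I_{\pmb\omega_0}\cdot\mathcal{M}$ is the linear span of $\{pf:p\in I_{\pmb\omega_0},f\in\mathcal{M}\}$. A pure isometrically isomorphic submodule of $\mathcal{R}$ is a submodule of the form $U\mathcal{R}$, where $U$ is an isometric module map on $\mathcal{R}$ with $\bigcap_{k\ge0}U^k\mathcal{R}=(0)$. *)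

theory Defs
  imports "HOL-Analysis.Analysis"
begin

section \<open>Complex Hilbert spaces\<close>

class complex_vector = real_vector +
  fixes scaleC :: "complex \<Rightarrow> 'a \<Rightarrow> 'a" (infixr \<open>*\<^sub>C\<close> 75)
  assumes scaleC_add_right: "a *\<^sub>C (x + y) = a *\<^sub>C x + a *\<^sub>C y"
    and scaleC_add_left: "(a + b) *\<^sub>C x = a *\<^sub>C x + b *\<^sub>C x"
    and scaleC_scaleC: "a *\<^sub>C (b *\<^sub>C x) = (a * b) *\<^sub>C x"
    and scaleC_one: "1 *\<^sub>C x = x"
    and scaleR_scaleC: "r *\<^sub>R x = complex_of_real r *\<^sub>C x"

global_interpretation complex_vector:
  vector_space "scaleC :: complex \<Rightarrow> 'a \<Rightarrow> 'a::complex_vector"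
  by unfold_locales (simp_all add: scaleC_add_right scaleC_add_left scaleC_scaleC scaleC_one)

text \<open>The complex inner product is linear in its first argument. Its real part is the inner
  product of \<^class>\<open>real_inner\<close>, so positivity, the norm and the topology are those of
  the underlying real inner product space.\<close>

class complex_inner = complex_vector + real_inner +
  fixes cinner :: "'a \<Rightarrow> 'a \<Rightarrow> complex"
  assumes cinner_add_left: "cinner (x + y) z = cinner x z + cinner y z"
    and cinner_scaleC_left: "cinner (c *\<^sub>C x) y = c * cinner x y"
    and cinner_commute: "cinner x y = cnj (cinner y x)"
    and inner_eq_Re_cinner: "inner x y = Re (cinner x y)"

class chilbert_space = complex_inner + complete_space

text \<open>\<open>V / S\<close> is finite-dimensional: finitely many cosets \<open>b + S\<close> span it.\<close>

definition finite_codim :: "'a::complex_vector set \<Rightarrow> bool" where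
  "finite_codim S \<longleftrightarrow>
     complex_vector.subspace S \<and>
     (\<exists>B. finite B \<and> (\<forall>v. \<exists>b\<in>complex_vector.span B. v - b \<in> S))"


section \<open>The algebra of a bounded domain\<close>

definition bounded_domain :: "(complex ^ 'n) set \<Rightarrow> bool" where
  "bounded_domain \<Omega> \<longleftrightarrow> open \<Omega> \<and> connected \<Omega> \<and> \<Omega> \<noteq> {} \<and> bounded \<Omega>"

definition holo_on :: "(complex ^ 'n \<Rightarrow> complex) \<Rightarrow> (complex ^ 'n) set \<Rightarrow> bool" where
  "holo_on f V \<longleftrightarrow> open V \<and>
     (\<forall>z\<in>V. \<exists>D. (f has_derivative D) (at z) \<and> (\<forall>c v. D (c *s v) = c * D v))"

text \<open>Functions on \<open>\<Omega>\<close> are represented by their extension by zero.\<close>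

definition restrict0 :: "'a set \<Rightarrow> ('a \<Rightarrow> complex) \<Rightarrow> 'a \<Rightarrow> complex" where
  "restrict0 \<Omega> f = (\<lambda>z. if z \<in> \<Omega> then f z else 0)"

text \<open>The completion \<open>A(\<Omega>)\<close> is realised inside the Banach space of bounded functions on \<open>\<Omega>\<close>,
  as the set of uniform limits.\<close>

definition A_alg :: "(complex ^ 'n) set \<Rightarrow> (complex ^ 'n \<Rightarrow> complex) set" where
  "A_alg \<Omega> = {f. restrict0 \<Omega> f = f \<and>
     (\<forall>e>0. \<exists>g V. closure \<Omega> \<subseteq> V \<and> holo_on g V \<and> (\<forall>z\<in>\<Omega>. norm (f z - g z) < e))}"

definition sup_norm :: "'a set \<Rightarrow> ('a \<Rightarrow> complex) \<Rightarrow> real" where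
  "sup_norm \<Omega> f = (SUP z\<in>\<Omega>. norm (f z))"

text \<open>Elements of \<open>\<complex>[z\<^sub>1, \<dots>, z\<^sub>n]\<close>, identified with the functions they induce on \<open>\<complex>\<^sup>n\<close>;
  \<open>\<alpha>\<close> ranges over multi-indices.\<close>

definition poly_funs :: "(complex ^ 'n \<Rightarrow> complex) set" where
  "poly_funs = {p. \<exists>S c. finite (S :: ('n \<Rightarrow> nat) set) \<and>
     p = (\<lambda>z. \<Sum>\<alpha>\<in>S. c \<alpha> * (\<Prod>i\<in>UNIV. (z $ i) ^ \<alpha> i))}"

definition max_ideal :: "complex ^ 'n \<Rightarrow> (complex ^ 'n \<Rightarrow> complex) set" where
  "max_ideal \<omega> = {p \<in> poly_funs. p \<omega> = 0}"


section \<open>Hilbert modules\<close>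

text \<open>\<open>act \<phi> x\<close> is the module product; it is only relevant for \<open>\<phi> \<in> A_alg \<Omega>\<close>.
  The unit of \<open>A(\<Omega>)\<close> is \<open>restrict0 \<Omega> (\<lambda>_. 1)\<close>.\<close>

locale hilbert_module =
  fixes \<Omega> :: "(complex ^ 'n) set"
    and act :: "(complex ^ 'n \<Rightarrow> complex) \<Rightarrow> 'h \<Rightarrow> 'h::chilbert_space"
  assumes separable: "\<exists>D::'h set. countable D \<and> closure D = UNIV"
    and act_add_right: "\<phi> \<in> A_alg \<Omega> \<Longrightarrow> act \<phi> (x + y) = act \<phi> x + act \<phi> y"
    and act_scaleC_right: "\<phi> \<in> A_alg \<Omega> \<Longrightarrow> act \<phi> (c *\<^sub>C x) = c *\<^sub>C act \<phi> x"
    and act_add_left: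
      "\<phi> \<in> A_alg \<Omega> \<Longrightarrow> \<psi> \<in> A_alg \<Omega> \<Longrightarrow> act (\<lambda>z. \<phi> z + \<psi> z) x = act \<phi> x + act \<psi> x"
    and act_scaleC_left: "\<phi> \<in> A_alg \<Omega> \<Longrightarrow> act (\<lambda>z. c * \<phi> z) x = c *\<^sub>C act \<phi> x"
    and act_mult:
      "\<phi> \<in> A_alg \<Omega> \<Longrightarrow> \<psi> \<in> A_alg \<Omega> \<Longrightarrow> act (\<lambda>z. \<phi> z * \<psi> z) x = act \<phi> (act \<psi> x)"
    and act_one: "act (restrict0 \<Omega> (\<lambda>_. 1)) x = x"
    and act_contractive: "\<phi> \<in> A_alg \<Omega> \<Longrightarrow> norm (act \<phi> x) \<le> sup_norm \<Omega> \<phi> * norm x"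

definition submodule ::
  "(complex ^ 'n) set \<Rightarrow> ((complex ^ 'n \<Rightarrow> complex) \<Rightarrow> 'h \<Rightarrow> 'h::chilbert_space) \<Rightarrow> 'h set \<Rightarrow> bool"
  where
  "submodule \<Omega> act S \<longleftrightarrow>
     complex_vector.subspace S \<and> closed S \<and> (\<forall>\<phi>\<in>A_alg \<Omega>. \<forall>x\<in>S. act \<phi> x \<in> S)"

definition isometric_module_map ::
  "(complex ^ 'n) set \<Rightarrow> ((complex ^ 'n \<Rightarrow> complex) \<Rightarrow> 'h \<Rightarrow> 'h::chilbert_space) \<Rightarrow> ('h \<Rightarrow> 'h) \<Rightarrow> bool"
  where
  "isometric_module_map \<Omega> act U \<longleftrightarrow>
     (\<forall>x y. U (x + y) = U x + U y) \<and> (\<forall>c x. U (c *\<^sub>C x) = c *\<^sub>C U x) \<and>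
     (\<forall>\<phi>\<in>A_alg \<Omega>. \<forall>x. U (act \<phi> x) = act \<phi> (U x)) \<and>
     (\<forall>x. norm (U x) = norm x)"

definition pure_isometric_submodule ::
  "(complex ^ 'n) set \<Rightarrow> ((complex ^ 'n \<Rightarrow> complex) \<Rightarrow> 'h \<Rightarrow> 'h::chilbert_space) \<Rightarrow> 'h set \<Rightarrow> bool"
  where
  "pure_isometric_submodule \<Omega> act S \<longleftrightarrow> submodule \<Omega> act S \<and>
     (\<exists>U. isometric_module_map \<Omega> act U \<and> S = range U \<and> (\<Inter>k. range (U ^^ k)) = {0})"

text \<open>The product \<open>I \<cdot> M\<close> is the algebraic linear span; no closure is taken.\<close>

definition ideal_times_module ::
  "(complex ^ 'n) set \<Rightarrow> ((complex ^ 'n \<Rightarrow> complex) \<Rightarrow> 'h \<Rightarrow> 'h::chilbert_space)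
     \<Rightarrow> (complex ^ 'n \<Rightarrow> complex) set \<Rightarrow> 'h set" where
  "ideal_times_module \<Omega> act I =
     complex_vector.span {act (restrict0 \<Omega> p) f | p f. p \<in> I}"

definition semi_fredholm_at ::
  "(complex ^ 'n) set \<Rightarrow> ((complex ^ 'n \<Rightarrow> complex) \<Rightarrow> 'h \<Rightarrow> 'h::chilbert_space)
     \<Rightarrow> complex ^ 'n \<Rightarrow> bool" where
  "semi_fredholm_at \<Omega> act \<omega> \<longleftrightarrow>
     hilbert_module \<Omega> act \<and> finite_codim (ideal_times_module \<Omega> act (max_ideal \<omega>))"


section \<open>Quasi-free Hilbert modules\<close>

text \<open>For finite \<open>m\<close>, \<open>\<complex>\<^sup>m\<close> is embedded in \<open>\<ell>\<^sup>2\<close> as the sequences supported on \<open>{..<m}\<close>.\<close>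

definition ell2 :: "enat \<Rightarrow> (nat \<Rightarrow> complex) set" where
  "ell2 m = {x. (\<forall>k. m \<le> enat k \<longrightarrow> x k = 0) \<and> summable (\<lambda>k. (norm (x k))\<^sup>2)}"

definition ell2_norm :: "(nat \<Rightarrow> complex) \<Rightarrow> real" where
  "ell2_norm x = sqrt (\<Sum>k. (norm (x k))\<^sup>2)"

text \<open>The algebraic tensor product \<open>A(\<Omega>) \<otimes> \<ell>\<^sup>2\<^sub>m\<close>, with \<open>\<Sum>i. \<theta>\<^sub>i \<otimes> x\<^sub>i\<close> represented by the
  vector-valued function \<open>z \<mapsto> \<Sum>i. \<theta>\<^sub>i(z) x\<^sub>i\<close>. This representation is faithful by
  \<open>tensor_representation_faithful\<close> below, since every tensor can be written with linearly
  independent \<open>x\<^sub>i\<close>. The evaluation map at \<open>z\<close> becomes \<open>F \<mapsto> F z\<close>.\<close>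

definition alg_tensor :: "(complex ^ 'n) set \<Rightarrow> enat \<Rightarrow> (complex ^ 'n \<Rightarrow> nat \<Rightarrow> complex) set" where
  "alg_tensor \<Omega> m = {F. \<exists>N \<theta> x. (\<forall>i<N. \<theta> i \<in> A_alg \<Omega> \<and> x i \<in> ell2 m) \<and>
     F = (\<lambda>z k. \<Sum>i<(N::nat). \<theta> i z * x i k)}"

lemma tensor_representation_faithful:
  fixes \<theta> :: "nat \<Rightarrow> complex ^ 'n \<Rightarrow> complex" and x :: "nat \<Rightarrow> nat \<Rightarrow> complex"
  assumes indep: "\<And>c. (\<forall>k. (\<Sum>i<N. c i * x i k) = 0) \<Longrightarrow> \<forall>i<N. c i = 0"
    and "(\<lambda>z k. \<Sum>i<N. \<theta> i z * x i k) = (\<lambda>z k. 0)"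
  shows "\<forall>i<N. \<theta> i = (\<lambda>z. 0)"
proof (intro allI impI ext)
  fix i z assume "i < N"
  have "\<forall>k. (\<Sum>i<N. \<theta> i z * x i k) = 0"
    using assms(2) by meson
  from indep[OF this] \<open>i < N\<close> show "\<theta> i z = 0" by blast
qed

text \<open>\<open>\<iota>\<close> embeds \<open>A(\<Omega>) \<otimes> \<ell>\<^sup>2\<^sub>m\<close> linearly, injectively and densely into the Hilbert space \<open>'h\<close>. This
  says that \<open>'h\<close> is the completion of the tensor product in the inner product
  \<open>(F, G) \<mapsto> cinner (\<iota> F) (\<iota> G)\<close>, and every inner product on the tensor product arises in this way.
  The module action is the extension of multiplication.\<close>

definition quasi_free_completion ::
  "(complex ^ 'n) set \<Rightarrow> ((complex ^ 'n \<Rightarrow> complex) \<Rightarrow> 'h \<Rightarrow> 'h::chilbert_space) \<Rightarrow> enat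
     \<Rightarrow> ((complex ^ 'n \<Rightarrow> nat \<Rightarrow> complex) \<Rightarrow> 'h) \<Rightarrow> bool" where
  "quasi_free_completion \<Omega> act m \<iota> \<longleftrightarrow>
     (let T = alg_tensor \<Omega> m in
      (\<forall>F\<in>T. \<forall>G\<in>T. \<iota> (\<lambda>z k. F z k + G z k) = \<iota> F + \<iota> G) \<and>
      (\<forall>c. \<forall>F\<in>T. \<iota> (\<lambda>z k. c * F z k) = c *\<^sub>C \<iota> F) \<and>
      inj_on \<iota> T \<and> closure (\<iota> ` T) = UNIV \<and>
      (\<forall>\<phi>\<in>A_alg \<Omega>. \<forall>F\<in>T. act \<phi> (\<iota> F) = \<iota> (\<lambda>z k. \<phi> z * F z k)) \<and>
      (\<forall>z\<in>\<Omega>. \<exists>C. \<forall>F\<in>T. ell2_norm (F z) \<le> C * norm (\<iota> F)) \<and>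
      (\<forall>z\<in>\<Omega>. \<exists>V C. open V \<and> z \<in> V \<and>
         (\<forall>w\<in>V \<inter> \<Omega>. \<forall>F\<in>T. ell2_norm (F w) \<le> C * norm (\<iota> F))) \<and>
      (\<forall>\<phi>\<in>A_alg \<Omega>. \<forall>F\<in>T. norm (\<iota> (\<lambda>z k. \<phi> z * F z k)) \<le> sup_norm \<Omega> \<phi> * norm (\<iota> F)) \<and>
      (\<forall>F::nat \<Rightarrow> _. (\<forall>i. F i \<in> T) \<and> Cauchy (\<lambda>i. \<iota> (F i)) \<longrightarrow>
         ((\<forall>z\<in>\<Omega>. (\<lambda>i. ell2_norm (F i z)) \<longlonglongrightarrow> 0) \<longleftrightarrow> (\<lambda>i. norm (\<iota> (F i))) \<longlonglongrightarrow> 0)))"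

definition quasi_free_of_rank ::
  "(complex ^ 'n) set \<Rightarrow> ((complex ^ 'n \<Rightarrow> complex) \<Rightarrow> 'h \<Rightarrow> 'h::chilbert_space) \<Rightarrow> enat \<Rightarrow> bool"
  where
  "quasi_free_of_rank \<Omega> act m \<longleftrightarrow>
     hilbert_module \<Omega> act \<and> (\<exists>\<iota>. quasi_free_completion \<Omega> act m \<iota>)"

definition quasi_free ::
  "(complex ^ 'n) set \<Rightarrow> ((complex ^ 'n \<Rightarrow> complex) \<Rightarrow> 'h \<Rightarrow> 'h::chilbert_space) \<Rightarrow> bool" where
  "quasi_free \<Omega> act \<longleftrightarrow> (\<exists>m\<ge>1. quasi_free_of_rank \<Omega> act m)"

end

theory Submission
  imports Defs "HOL-Complex_Analysis.Conformal_Mappings" "Jordan_Normal_Form.Char_Poly"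
begin

text \<open>Since \<open>U\<close> is a pure isometry whose range has finite codimension, it is a unilateral shift of finite
  multiplicity \<open>d\<close> (Wold decomposition), and each coordinate multiplication, which commutes with \<open>U\<close>,
  has as its symbol a \<open>d \<times> d\<close> matrix \<open>H\<^sub>i(w)\<close> holomorphic on the unit disc. Evaluation at \<open>\<omega> \<in> \<Omega>\<close>
  is a nonzero functional annihilating \<open>I\<^sub>\<omega> \<cdot> \<R>\<close>. The functionals annihilating \<open>I\<^sub>\<omega> \<cdot> \<R>\<close> form a
  finite-dimensional space invariant under composition with \<open>U\<close>, so it contains an eigenvector,
  with eigenvalue \<open>w\<close> say; purity forces \<open>|w| < 1\<close>, and then \<open>\<omega>\<^sub>i\<close> is an eigenvalue of \<open>H\<^sub>i(w)\<close> for
  every \<open>i\<close>. If there were two coordinates \<open>i \<noteq> j\<close>, fix a value \<open>x\<close> of \<open>\<omega>\<^sub>i\<close> that is not an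
  eigenvalue of \<open>H\<^sub>i(0)\<close>. Then \<open>det (H\<^sub>i(w) - x)\<close> has only countably many zeros \<open>w\<close>, each of which
  admits finitely many \<open>\<omega>\<^sub>j\<close>, whereas \<open>\<omega>\<^sub>j\<close> ranges over a disc.\<close>


section \<open>Holomorphic matrix functions\<close>

lemma finite_eigenvalues:
  fixes A :: "complex mat"
  assumes A: "A \<in> carrier_mat n n"
  shows "finite {x. eigenvalue A x}"
proof -
  have "char_poly A \<noteq> 0"
    using degree_monic_char_poly[OF A] by (metis coeff_0 zero_neq_one)
  then show ?thesis
    using poly_roots_finite eigenvalue_root_char_poly[OF A] by simp
qed

text \<open>Phrased for plain functions because the entries \<open>v j\<close> will be the values of
  one functional on a basis of the wandering subspace.\<close>

lemma eigenvalue_matI: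
  fixes v :: "nat \<Rightarrow> complex"
  assumes "i < n" "v i \<noteq> 0" and eq: "\<And>j. j < n \<Longrightarrow> (\<Sum>l<n. H j l * v l) = x * v j"
  shows "eigenvalue (mat n n (\<lambda>(j, l). H j l)) x"
proof -
  have "Matrix.vec n v \<noteq> 0\<^sub>v n"
    using assms(1,2) by (metis index_vec index_zero_vec(1))
  moreover have "mat n n (\<lambda>(j, l). H j l) *\<^sub>v Matrix.vec n v = x \<cdot>\<^sub>v Matrix.vec n v"
    by (rule eq_vecI) (auto simp: scalar_prod_def eq atLeast0LessThan)
  ultimately show ?thesis
    unfolding eigenvalue_def eigenvector_def by (intro exI[of _ "Matrix.vec n v"]) auto
qed

text \<open>By the Leibniz formula the determinant is a polynomial in the entries, each of which is
  holomorphic.\<close>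

lemma holomorphic_on_det_char_matrix:
  fixes H :: "complex \<Rightarrow> nat \<Rightarrow> nat \<Rightarrow> complex"
  assumes "\<And>j l. j < n \<Longrightarrow> l < n \<Longrightarrow> (\<lambda>w. H w j l) holomorphic_on S"
  shows "(\<lambda>w. Determinant.det (char_matrix (mat n n (\<lambda>(j, l). H w j l)) x)) holomorphic_on S"
proof -
  have "Determinant.det (char_matrix (mat n n (\<lambda>(j, l). H w j l)) x) =
     (\<Sum>p | p permutes {0..<n}. signof p * (\<Prod>i=0..<n. H w i (p i) - (if i = p i then x else 0)))" for w
  proof -
    have "p i < n" if "p permutes {0..<n}" "i < n" for p i
      using that by (metis atLeastLessThan_iff permutes_in_image zero_le)
    then show ?thesis
      by (subst det_def'[OF char_matrix_closed[OF mat_carrier]])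
        (auto intro!: sum.cong prod.cong simp: char_matrix_def)
  qed
  moreover have "(\<lambda>w. H w i (p i)) holomorphic_on S" if "p permutes {0..<n}" "i \<in> {0..<n}" for p i
    using that assms by (metis atLeastLessThan_iff permutes_in_image)
  ultimately show ?thesis
    by (auto intro!: holomorphic_intros)
qed

lemma underdetermined_system:
  fixes a :: "nat \<Rightarrow> nat \<Rightarrow> complex"
  shows "\<exists>v. (\<exists>k\<le>N. v k \<noteq> 0) \<and> (\<forall>i<N. (\<Sum>k\<le>N. a i k * v k) = 0)"
proof -
  \<comment> \<open>A zero row makes the system square, with vanishing determinant.\<close>
  define A where "A = mat (Suc N) (Suc N) (\<lambda>(i, k). if i < N then a i k else 0)"
  have A: "A \<in> carrier_mat (Suc N) (Suc N)"
    by (simp add: A_def)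
  have "row A N = 0\<^sub>v (Suc N)"
    by (auto simp: A_def)
  then have "Determinant.det A = 0"
    by (subst laplace_expansion_row[OF A, of N]) (auto simp: A_def intro!: sum.neutral)
  then obtain v where v: "v \<in> carrier_vec (Suc N)" "v \<noteq> 0\<^sub>v (Suc N)" "A *\<^sub>v v = 0\<^sub>v (Suc N)"
    using det_0_iff_vec_prod_zero[OF A] by auto
  have "\<exists>k\<le>N. vec_index v k \<noteq> 0"
    using v by (metis carrier_vecD eq_vecI index_zero_vec less_Suc_eq_le)
  moreover have "(\<Sum>k\<le>N. a i k * vec_index v k) = 0" if "i < N" for i
  proof -
    have "vec_index (A *\<^sub>v v) i = 0"
      using v that by simp
    then show ?thesis
      using that v(1) by (simp add: A_def scalar_prod_def atLeast0LessThan lessThan_Suc_atMost)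
  qed
  ultimately show ?thesis by blast
qed

section \<open>Complex inner products and projections\<close>

text \<open>A minimizing sequence for the distance from \<open>x\<close> to \<open>S\<close> is
  Cauchy by the parallelogram law, and its limit \<open>p\<close> is a nearest point. Moving
  \<open>p\<close> within \<open>S\<close> cannot shorten \<open>x - p\<close>, which forces
  orthogonality. Only the real inner product enters.\<close>

lemma closed_subspace_projection:
  fixes S :: "'a::{real_inner, complete_space} set"
  assumes S: "subspace S" "closed S"
  shows "\<exists>p\<in>S. \<forall>s\<in>S. inner (x - p) s = 0"
proof -
  define d where "d = (INF s\<in>S. (norm (x - s))\<^sup>2)"
  have ne: "S \<noteq> {}"
    using S(1) subspace_0 by blast
  have bdd: "bdd_below ((\<lambda>s. (norm (x - s))\<^sup>2) ` S)"
    by (rule bdd_belowI[of _ 0]) auto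
  have d_le: "d \<le> (norm (x - s))\<^sup>2" if "s \<in> S" for s
    unfolding d_def by (rule cINF_lower[OF bdd that])
  have "\<exists>s\<in>S. (norm (x - s))\<^sup>2 < d + inverse (real (Suc n))" for n
    using cINF_less_iff[OF ne bdd, of "d + inverse (real (Suc n))"] unfolding d_def by auto
  then obtain s where s: "\<And>n. s n \<in> S" "\<And>n. (norm (x - s n))\<^sup>2 < d + inverse (real (Suc n))"
    by metis
  have close: "(norm (s m - s n))\<^sup>2 \<le> 2 * inverse (real (Suc m)) + 2 * inverse (real (Suc n))" for m n
  proof -
    have "(1/2) *\<^sub>R (s m + s n) \<in> S"
      using S(1) s(1) by (simp add: subspace_add subspace_scale)
    then have "d \<le> (norm (x - (1/2) *\<^sub>R (s m + s n)))\<^sup>2"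
      by (rule d_le)
    \<comment> \<open>Parallelogram law for \<open>x - s m\<close> and \<open>x - s n\<close>; the
      midpoint lies in \<open>S\<close>, so its distance term is at least
      \<open>4 * d\<close>.\<close>
    moreover have "(norm (s m - s n))\<^sup>2 + 4 * (norm (x - (1/2) *\<^sub>R (s m + s n)))\<^sup>2
        = 2 * (norm (x - s m))\<^sup>2 + 2 * (norm (x - s n))\<^sup>2"
      by (simp add: power2_norm_eq_inner inner_simps inner_commute field_simps)
    ultimately show ?thesis
      using s(2)[of m] s(2)[of n] by linarith
  qed
  have "Cauchy s"
  proof (rule metric_CauchyI)
    fix e :: real assume "e > 0"
    obtain N where N: "inverse (real (Suc N)) < e\<^sup>2 / 4"
      using reals_Archimedean[of "e\<^sup>2 / 4"] \<open>e > 0\<close> by auto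
    have "dist (s m) (s n) < e" if "m \<ge> N" "n \<ge> N" for m n
    proof -
      have "inverse (real (Suc m)) \<le> inverse (real (Suc N))"
        "inverse (real (Suc n)) \<le> inverse (real (Suc N))"
        using that by (auto intro!: le_imp_inverse_le)
      then have "(norm (s m - s n))\<^sup>2 < e\<^sup>2"
        using close[of m n] N by linarith
      then show ?thesis
        using \<open>e > 0\<close> by (simp add: dist_norm power_less_imp_less_base)
    qed
    then show "\<exists>M. \<forall>m\<ge>M. \<forall>n\<ge>M. dist (s m) (s n) < e" by blast
  qed
  then obtain p where p: "s \<longlonglongrightarrow> p"
    by (auto simp: Cauchy_convergent_iff convergent_def)
  have "p \<in> S"
    using S(2) s(1) p closed_sequentially by blast
  have "(norm (x - p))\<^sup>2 \<le> d + 0"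
  proof (rule LIMSEQ_le)
    show "(\<lambda>n. (norm (x - s n))\<^sup>2) \<longlonglongrightarrow> (norm (x - p))\<^sup>2"
      by (intro tendsto_intros p)
    show "(\<lambda>n. d + inverse (real (Suc n))) \<longlonglongrightarrow> d + 0"
      by (intro tendsto_intros LIMSEQ_inverse_real_of_nat)
  qed (use s(2) in \<open>auto intro: less_imp_le\<close>)
  have "inner (x - p) u = 0" if "u \<in> S" for u
  proof (cases "u = 0")
    case False
    \<comment> \<open>This \<open>t\<close> minimizes the quadratic
      \<open>norm (x - p - t *\<^sub>R u)\<close> squared; the decrease it would produce is the
      squared inner product divided by the squared norm of \<open>u\<close>.\<close>
    define t where "t = inner (x - p) u / (norm u)\<^sup>2"
    have "p + t *\<^sub>R u \<in> S"
      using S(1) \<open>p \<in> S\<close> \<open>u \<in> S\<close> by (simp add: subspace_add subspace_scale)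
    from d_le[OF this] \<open>(norm (x - p))\<^sup>2 \<le> d + 0\<close>
    have "(norm (x - p))\<^sup>2 \<le> (norm (x - p - t *\<^sub>R u))\<^sup>2"
      unfolding diff_diff_eq by linarith
    also have "\<dots> = (norm (x - p))\<^sup>2 - 2 * t * inner (x - p) u + t\<^sup>2 * (norm u)\<^sup>2"
      unfolding power2_norm_eq_inner
      by (simp add: inner_diff_left inner_diff_right inner_commute power2_eq_square algebra_simps)
    also have "\<dots> = (norm (x - p))\<^sup>2 - (inner (x - p) u)\<^sup>2 / (norm u)\<^sup>2"
      using False by (simp add: t_def power2_eq_square)
    finally have "(inner (x - p) u)\<^sup>2 / (norm u)\<^sup>2 \<le> 0" by simp
    then show ?thesis
      using False by (simp add: divide_le_0_iff)
  qed simp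
  then show ?thesis
    using \<open>p \<in> S\<close> by blast
qed

section \<open>Complex Cauchy-Schwarz inequality and orthonormal expansions\<close>

lemma cinner_scaleC_right: "cinner x (c *\<^sub>C y) = cnj c * cinner x y"
  by (metis cinner_commute cinner_scaleC_left complex_cnj_mult)

lemma cinner_self: "cinner x x = of_real ((norm x)\<^sup>2)"
proof (rule complex_eqI)
  show "Im (cinner x x) = Im (complex_of_real ((norm x)\<^sup>2))"
    using arg_cong[OF cinner_commute[of x x], of Im] by simp
qed (simp add: power2_norm_eq_inner inner_eq_Re_cinner)

lemma norm_scaleC: "norm (c *\<^sub>C x) = cmod c * norm (x :: 'a::complex_inner)"
proof -
  have "complex_of_real ((norm (c *\<^sub>C x))\<^sup>2) = of_real ((cmod c * norm x)\<^sup>2)"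
    unfolding cinner_self[symmetric] cinner_scaleC_left cinner_scaleC_right
    using complex_norm_square[of c] by (simp add: cinner_self power_mult_distrib mult_ac)
  then show ?thesis
    unfolding of_real_eq_iff by (simp add: power2_eq_iff_nonneg)
qed

text \<open>A unimodular factor \<open>u\<close> rotates \<open>cinner x y\<close> onto the positive
  real axis, where it equals a real inner product and the real Cauchy-Schwarz inequality
  applies.\<close>

lemma norm_cinner_le: "cmod (cinner x y) \<le> norm x * norm y"
proof (cases "cinner x y = 0")
  case False
  define u where "u = cnj (cinner x y) / cmod (cinner x y)"
  have u: "cmod u = 1"
    using False by (simp add: u_def norm_divide)
  have "u * cinner x y = cmod (cinner x y)"
    using False by (simp add: u_def field_simps complex_norm_square[symmetric] power2_eq_square)
  then have "cmod (cinner x y) = inner (u *\<^sub>C x) y"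
    by (simp add: inner_eq_Re_cinner cinner_scaleC_left)
  also have "\<dots> \<le> norm x * norm y"
    using norm_cauchy_schwarz[of "u *\<^sub>C x" y] by (simp add: norm_scaleC u)
  finally show ?thesis .
qed simp

lemma cinner_zero_left [simp]: "cinner 0 y = 0"
  using cinner_add_left[of 0 0 y] by simp

lemma cinner_diff_left: "cinner (x - y) z = cinner x z - cinner y z"
  using cinner_add_left[of "x - y" y z] by simp

lemma cinner_sum_left: "cinner (\<Sum>i\<in>I. f i) y = (\<Sum>i\<in>I. cinner (f i) y)"
  by (induction I rule: infinite_finite_induct) (auto simp: cinner_add_left)

text \<open>Gram-Schmidt, one vector at a time: the residual \<open>r\<close> of the new vector is
  normalized and appended, unless it is zero. Indexing by naturals below \<open>d\<close> matches
  the matrix indices used later.\<close>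

lemma finite_orthonormal_expansion:
  fixes C :: "'a::complex_inner set"
  assumes "finite C"
  shows "\<exists>d::nat. \<exists>e. (\<forall>i<d. \<forall>j<d. cinner (e i) (e j) = (if i = j then 1 else 0)) \<and>
     (\<forall>v\<in>C. v = (\<Sum>l<d. cinner v (e l) *\<^sub>C e l))"
  using assms
proof (induction C)
  case empty
  show ?case by (intro exI[of _ 0]) auto
next
  case (insert b C)
  then obtain d :: nat and e where
    *: "(\<forall>i<d. \<forall>j<d. cinner (e i) (e j) = (if i = j then 1 else 0)) \<and>
      (\<forall>v\<in>C. v = (\<Sum>l<d. cinner v (e l) *\<^sub>C e l))"
    by (elim exE) (rule that)
  have on: "cinner (e i) (e j) = (if i = j then 1 else 0)" if "i < d" "j < d" for i j
    using conjunct1[OF *] that by blast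
  note C = conjunct2[OF *, THEN bspec]
  define p where "p = (\<Sum>l<d. cinner b (e l) *\<^sub>C e l)"
  define r where "r = b - p"
  have r_e: "cinner r (e j) = 0" if "j < d" for j
    using that by (simp add: r_def p_def cinner_diff_left cinner_sum_left cinner_scaleC_left on if_distrib
        cong: if_cong)
  show ?case
  proof (cases "r = 0")
    case True
    then have b: "b = (\<Sum>l<d. cinner b (e l) *\<^sub>C e l)"
      by (simp add: r_def p_def)
    show ?thesis
    proof (intro exI[of _ d] exI[of _ e] conjI ballI)
      fix v assume "v \<in> insert b C"
      then show "v = (\<Sum>l<d. cinner v (e l) *\<^sub>C e l)"
        using b C[of v] by (elim insertE) (simp only:)
    qed (use on in blast)
  next
    case False
    define e' where "e' = e(d := complex_of_real (1 / norm r) *\<^sub>C r)"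
    have e': "e' i = e i" if "i < d" for i
      using that by (simp add: e'_def)
    have e'd: "e' d = complex_of_real (1 / norm r) *\<^sub>C r"
      by (simp add: e'_def)
    have orth: "cinner (e' d) (e j) = 0" "cinner (e j) (e' d) = 0" if "j < d" for j
      using r_e[OF that] cinner_commute[of "e j" r]
      by (simp_all add: e'd cinner_scaleC_left cinner_scaleC_right)
    have one: "cinner (e' d) (e' d) = 1"
      using False by (simp add: e'd cinner_self norm_scaleC norm_divide)
    have "cinner (e' i) (e' j) = (if i = j then 1 else 0)" if "i < Suc d" "j < Suc d" for i j
      using that on orth one e' by (cases "i = d"; cases "j = d") (auto simp: less_Suc_eq)
    moreover have "v = (\<Sum>l<Suc d. cinner v (e' l) *\<^sub>C e' l)" if "v \<in> insert b C" for v
    proof -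
      have *: "(\<Sum>l<Suc d. cinner v (e' l) *\<^sub>C e' l)
          = (\<Sum>l<d. cinner v (e l) *\<^sub>C e l) + cinner v (e' d) *\<^sub>C e' d" for v
        by (simp add: e')
      have comb: "cinner (\<Sum>l<d. c l *\<^sub>C e l) (e' d) = 0" for c
        by (simp add: cinner_sum_left cinner_scaleC_left orth)
      show ?thesis
      proof (cases "v = b")
        case True
        have "cinner b (e' d) = cinner r (e' d) + cinner p (e' d)"
          by (simp add: r_def cinner_diff_left)
        also have "\<dots> = norm r"
          using False comb[of "\<lambda>l. cinner b (e l)"]
          by (simp add: p_def e'd cinner_scaleC_right cinner_self power2_eq_square)
        finally have "cinner b (e' d) *\<^sub>C e' d = r"
          using False by (simp add: e'd scaleC_scaleC scaleC_one)
        then show ?thesis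
          unfolding * True by (simp add: r_def p_def)
      next
        case False
        then have "v = (\<Sum>l<d. cinner v (e l) *\<^sub>C e l)"
          using that by (intro C) simp
        moreover have "cinner v (e' d) = 0"
          by (subst \<open>v = _\<close>) (rule comb)
        ultimately show ?thesis
          unfolding * by simp
      qed
    qed
    ultimately show ?thesis
      by (intro exI[of _ "Suc d"] exI[of _ e'] conjI allI impI ballI)
  qed
qed

text \<open>Both sides of the expansion are linear in \<open>v\<close>, so the vectors that satisfy
  it form a subspace containing \<open>C\<close>.\<close>

lemma span_orthonormal_expansion:
  assumes C: "\<And>v. v \<in> C \<Longrightarrow> v = (\<Sum>l<d. cinner v (e l) *\<^sub>C e l)"
    and "v \<in> complex_vector.span C"
  shows "v = (\<Sum>l<(d::nat). cinner v (e l) *\<^sub>C e l)"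
proof -
  have "complex_vector.subspace {v. v = (\<Sum>l<d. cinner v (e l) *\<^sub>C e l)}"
  proof (intro complex_vector.subspaceI)
    fix c v assume "v \<in> {v. v = (\<Sum>l<d. cinner v (e l) *\<^sub>C e l)}"
    then show "c *\<^sub>C v \<in> {v. v = (\<Sum>l<d. cinner v (e l) *\<^sub>C e l)}"
      by (simp add: cinner_scaleC_left flip: scaleC_scaleC complex_vector.scale_sum_right)
  qed (simp_all add: cinner_add_left scaleC_add_left sum.distrib)
  then show ?thesis
    using complex_vector.span_minimal[of C "{v. v = (\<Sum>l<d. cinner v (e l) *\<^sub>C e l)}"] assms by blast
qed

section \<open>Pure isometries of finite multiplicity\<close>

text \<open>\<open>bounded_linear\<close> expresses linearity over the reals only; the second
  conjunct makes the functional complex linear.\<close>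

definition bounded_functional :: "('h::chilbert_space \<Rightarrow> complex) \<Rightarrow> bool" where
  "bounded_functional g \<longleftrightarrow> bounded_linear g \<and> (\<forall>c x. g (c *\<^sub>C x) = c * g x)"

locale pure_isometry =
  fixes U :: "'h::chilbert_space \<Rightarrow> 'h"
  assumes U_add: "U (x + y) = U x + U y"
    and U_scaleC: "U (c *\<^sub>C x) = c *\<^sub>C U x"
    and norm_U: "norm (U x) = norm x"
    and pure: "(\<Inter>k. range (U ^^ k)) = {0}"
begin

text \<open>The orthogonal complement of the range of \<open>U\<close>. Real orthogonality gives the
  same set as complex orthogonality, because the range is closed under multiplication by the
  imaginary unit.\<close>

definition wandering :: "'h set" where
  "wandering = {e. \<forall>x. inner e (U x) = 0}"

lemma bounded_linear_U: "bounded_linear U"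
  by (rule bounded_linear_intro[of _ 1]) (simp_all add: U_add U_scaleC scaleR_scaleC norm_U)

lemma bounded_linear_U_pow: "bounded_linear (U ^^ k)"
proof (induction k)
  case 0
  then show ?case
    by (simp add: id_def bounded_linear_ident)
next
  case (Suc k)
  then show ?case
    using bounded_linear_compose[OF bounded_linear_U] by (simp add: comp_def)
qed

lemma U_pow_scaleC: "(U ^^ k) (c *\<^sub>C x) = c *\<^sub>C (U ^^ k) x"
  by (induction k) (simp_all add: U_scaleC)

lemma norm_U_pow: "norm ((U ^^ k) x) = norm x"
  by (induction k) (simp_all add: norm_U)

lemma closed_range_U_pow: "closed (range (U ^^ k))"
  by (intro complete_imp_closed complete_isometric_image[of 1])
    (simp_all add: bounded_linear_U_pow norm_U_pow complete_UNIV)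

section \<open>Wandering subspace and Wold decomposition\<close>

lemma wandering_decomposition: "\<exists>y. x - U y \<in> wandering"
proof -
  have "closed (range U)"
    using closed_range_U_pow[of 1] by simp
  moreover have "subspace (range U)"
    using linear_subspace_image[OF bounded_linear.linear[OF bounded_linear_U] subspace_UNIV] .
  ultimately show ?thesis
    using closed_subspace_projection[of "range U" x] unfolding wandering_def by auto
qed

lemma subspace_wandering: "complex_vector.subspace wandering"
proof (intro complex_vector.subspaceI)
  fix c e assume "e \<in> wandering"
  then have e: "inner e (U x) = 0" for x
    by (simp add: wandering_def)
  have "cinner e (U x) = 0" for x
  proof (rule complex_eqI)
    show "Re (cinner e (U x)) = Re 0"
      using e[of x] by (simp add: inner_eq_Re_cinner)
    \<comment> \<open>Testing against \<open>\<i> *\<^sub>C x\<close> turns the imaginary part into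
      a real part.\<close>
    show "Im (cinner e (U x)) = Im 0"
      using e[of "\<i> *\<^sub>C x"] by (simp add: inner_eq_Re_cinner U_scaleC cinner_scaleC_right)
  qed
  then show "c *\<^sub>C e \<in> wandering"
    by (simp add: wandering_def inner_eq_Re_cinner cinner_scaleC_left)
qed (simp_all add: wandering_def inner_add_left)

lemma wandering_pythagoras:
  "e \<in> wandering \<Longrightarrow> (norm (e + U z))\<^sup>2 = (norm e)\<^sup>2 + (norm z)\<^sup>2"
  unfolding norm_U[of z, symmetric] power2_norm_eq_inner
  by (simp add: wandering_def inner_simps inner_commute)

text \<open>\<open>e k\<close> is the wandering part of the remainder \<open>y k\<close>, and
  \<open>y (Suc k)\<close> is the next remainder. Unrolling gives \<open>x\<close> as the sum of
  \<open>(U ^^ k) (e k)\<close> over \<open>k < N\<close> plus the tail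
  \<open>(U ^^ N) (y N)\<close>; the recursive form avoids infinite sums of vectors.\<close>

lemma wold_expansion:
  obtains e y where "y 0 = x" "\<And>k. e k \<in> wandering" "\<And>k. y k = e k + U (y (Suc k))"
proof -
  obtain L where L: "\<And>x. x - U (L x) \<in> wandering"
    using wandering_decomposition by metis
  show ?thesis
    by (rule that[of "\<lambda>k. (L ^^ k) x" "\<lambda>k. (L ^^ k) x - U ((L ^^ Suc k) x)"]) (simp_all add: L)
qed

lemma wold_norms:
  assumes "\<And>k. e k \<in> wandering" "\<And>k. y k = e k + U (y (Suc k))"
  shows "norm (e k) \<le> norm (y 0)" "norm (y k) \<le> norm (y 0)"
proof -
  have *: "(norm (y k))\<^sup>2 = (norm (e k))\<^sup>2 + (norm (y (Suc k)))\<^sup>2" for k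
    using wandering_pythagoras[OF assms(1)] assms(2) by metis
  have "norm (y (Suc k)) \<le> norm (y k)" "norm (e k) \<le> norm (y k)" for k
    by (rule power2_le_imp_le; simp add: *[of k])+
  moreover from this have "norm (y k) \<le> norm (y 0)" for k
    by (induction k) (auto intro: order_trans)
  ultimately show "norm (e k) \<le> norm (y 0)" "norm (y k) \<le> norm (y 0)"
    by (blast intro: order_trans)+
qed

text \<open>This is where purity acts. By Pythagoras the squared distance of two tails is the
  difference of two terms of the decreasing convergent sequence of squared norms of
  \<open>y k\<close>, so the tails are Cauchy. From index \<open>k\<close> on they lie in the closed
  range of \<open>U ^^ k\<close>, hence the limit lies in every such range and is 0.\<close>

lemma wold_tail:
  assumes e: "\<And>k. e k \<in> wandering" and y: "\<And>k. y k = e k + U (y (Suc k))"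
  shows "(\<lambda>k. (U ^^ k) (y k)) \<longlonglongrightarrow> 0"
proof -
  define t where "t k = (U ^^ k) (y k)" for k
  have pyth: "(norm (y k))\<^sup>2 = (norm (e k))\<^sup>2 + (norm (y (Suc k)))\<^sup>2" for k
    using wandering_pythagoras[OF e] y by metis
  have diff: "(norm (y k - (U ^^ m) (y (k + m))))\<^sup>2 = (norm (y k))\<^sup>2 - (norm (y (k + m)))\<^sup>2" for k m
  proof (induction m arbitrary: k)
    case (Suc m)
    have "y k - (U ^^ Suc m) (y (k + Suc m)) = e k + U (y (Suc k) - (U ^^ m) (y (Suc k + m)))"
      by (subst y) (simp add: bounded_linear.linear[OF bounded_linear_U, THEN linear_diff])
    then have "(norm (y k - (U ^^ Suc m) (y (k + Suc m))))\<^sup>2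
        = (norm (e k))\<^sup>2 + (norm (y (Suc k) - (U ^^ m) (y (Suc k + m))))\<^sup>2"
      by (simp add: wandering_pythagoras[OF e])
    then show ?case
      using Suc[of "Suc k"] pyth[of k] by simp
  qed simp
  have t_diff: "(norm (t k - t (k + m)))\<^sup>2 = (norm (y k))\<^sup>2 - (norm (y (k + m)))\<^sup>2" for k m
  proof -
    have "t k - t (k + m) = (U ^^ k) (y k - (U ^^ m) (y (k + m)))"
      unfolding t_def
      by (simp add: funpow_add bounded_linear.linear[OF bounded_linear_U_pow, THEN linear_diff])
    then show ?thesis
      by (simp add: norm_U_pow diff)
  qed
  have "decseq (\<lambda>k. (norm (y k))\<^sup>2)"
  proof (rule decseq_SucI)
    show "(norm (y (Suc k)))\<^sup>2 \<le> (norm (y k))\<^sup>2" for k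
      unfolding pyth[of k] by (rule le_add_same_cancel2[THEN iffD2]) simp
  qed
  then obtain L where "(\<lambda>k. (norm (y k))\<^sup>2) \<longlonglongrightarrow> L" and L: "\<And>k. L \<le> (norm (y k))\<^sup>2"
    by (rule decseq_convergent[of _ 0]) auto
  have "Cauchy t"
  proof (rule CauchyI')
    fix r :: real assume "r > 0"
    then have "eventually (\<lambda>k. (norm (y k))\<^sup>2 < L + r\<^sup>2) sequentially"
      using order_tendstoD(2)[OF \<open>_ \<longlonglongrightarrow> L\<close>] by simp
    then obtain M where M: "\<And>k. k \<ge> M \<Longrightarrow> (norm (y k))\<^sup>2 < L + r\<^sup>2"
      by (auto simp: eventually_sequentially)
    have "norm (t m - t n) < r" if "m \<ge> M" "m < n" for m n
    proof -
      have "(norm (t m - t n))\<^sup>2 < r\<^sup>2"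
        using t_diff[of m "n - m"] M[of m] L[of n] that by simp
      then show ?thesis
        using \<open>r > 0\<close> by (simp add: power_less_imp_less_base)
    qed
    then show "\<exists>M. \<forall>m\<ge>M. \<forall>n>m. dist (t m) (t n) < r"
      unfolding dist_norm by blast
  qed
  then obtain l where l: "t \<longlonglongrightarrow> l"
    by (auto simp: Cauchy_convergent_iff convergent_def)
  have "l \<in> range (U ^^ k)" for k
  proof (rule closed_sequentially[OF closed_range_U_pow])
    show "(\<lambda>m. t (m + k)) \<longlonglongrightarrow> l"
      using l by (rule LIMSEQ_ignore_initial_segment)
    show "t (m + k) \<in> range (U ^^ k)" for m
      unfolding t_def by (subst add.commute) (simp add: funpow_add)
  qed
  then have "l = 0"
    using pure by blast
  then show ?thesis
    using l by (simp add: t_def[abs_def])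
qed

section \<open>Eigenfunctionals of composition with the isometry\<close>

lemma eigenfunctional_pow:
  fixes g :: "'h \<Rightarrow> complex"
  assumes gU: "\<And>x. g (U x) = w * g x"
  shows "g ((U ^^ k) x) = w ^ k * g x"
  by (induction k) (simp_all add: gU)

text \<open>If the modulus of \<open>w\<close> were at least 1, a growth argument would make
  \<open>g\<close> vanish on the wandering subspace. Then \<open>g\<close> could not distinguish
  \<open>x\<close> from its Wold tails, which tend to 0, so \<open>g x\<close> would be 0.\<close>

lemma eigenvalue_in_disc:
  assumes g: "bounded_functional g" and gU: "\<And>x. g (U x) = w * g x" and "g x \<noteq> 0"
  shows "cmod w < 1"
proof (rule ccontr)
  assume "\<not> cmod w < 1"
  then have w: "w \<noteq> 0" "cmod (inverse w) \<le> 1"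
    by (auto simp: norm_inverse inverse_le_1_iff)
  have lin: "bounded_linear g" and scaleC: "\<And>c x. g (c *\<^sub>C x) = c * g x"
    using g by (auto simp: bounded_functional_def)
  then interpret g: bounded_linear g by simp
  obtain K where K: "\<And>x. cmod (g x) \<le> norm x * K"
    using g.bounded by blast
  \<comment> \<open>The orthogonal sums \<open>s N = \<Sum>k<N. w\<^sup>-\<^sup>k U\<^sup>k e\<close> have norm at most \<open>sqrt N * norm e\<close>, but \<open>g (s N) = N * g e\<close>.\<close>
  have zero: "g e = 0" if e: "e \<in> wandering" for e
  proof -
    define s where "s = rec_nat 0 (\<lambda>_ z. e + U (inverse w *\<^sub>C z))"
    \<comment> \<open>Horner form of the sum: each step adds \<open>e\<close> to a vector in the
      range of \<open>U\<close>, so \<open>wandering_pythagoras\<close> controls the norm.\<close>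
    have s: "s 0 = 0" "s (Suc N) = e + U (inverse w *\<^sub>C s N)" for N
      by (simp_all add: s_def)
    have gs: "g (s N) = of_nat N * g e" for N
      using w(1) by (induction N) (simp_all add: s g.zero g.add gU scaleC algebra_simps)
    have ns: "(norm (s N))\<^sup>2 \<le> real N * (norm e)\<^sup>2" for N
    proof (induction N)
      case (Suc N)
      have "(norm (inverse w *\<^sub>C s N))\<^sup>2 \<le> (1 * norm (s N))\<^sup>2"
        unfolding norm_scaleC by (intro power_mono mult_right_mono w) auto
      then have "(norm (s (Suc N)))\<^sup>2 \<le> (norm e)\<^sup>2 + (norm (s N))\<^sup>2"
        unfolding s(2) wandering_pythagoras[OF e] by simp
      with Suc show ?case
        by (simp add: algebra_simps)
    qed (simp add: s)
    have bound: "real N * (cmod (g e))\<^sup>2 \<le> K\<^sup>2 * (norm e)\<^sup>2" if "N > 0" for N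
    proof -
      have "(real N * cmod (g e))\<^sup>2 \<le> (norm (s N) * K)\<^sup>2"
        using K[of "s N"] by (intro power_mono) (simp_all add: gs norm_mult)
      also have "\<dots> \<le> real N * (norm e)\<^sup>2 * K\<^sup>2"
        unfolding power_mult_distrib by (intro mult_right_mono ns) auto
      finally show ?thesis
        using that by (simp add: power2_eq_square algebra_simps)
    qed
    show ?thesis
    proof (rule ccontr)
      assume "g e \<noteq> 0"
      then obtain N :: nat where "K\<^sup>2 * (norm e)\<^sup>2 < real N * (cmod (g e))\<^sup>2"
        using reals_Archimedean3[of "(cmod (g e))\<^sup>2"] by auto
      then show False
        using bound[of N] by (cases "N = 0") (auto simp: mult_less_0_iff)
    qed
  qed
  obtain e y where y: "y 0 = x" "\<And>k. e k \<in> wandering" "\<And>k. y k = e k + U (y (Suc k))"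
    by (rule wold_expansion[of x]) (rule that)
  have "g ((U ^^ k) (y k)) = g x" for k
  proof (induction k)
    case (Suc k)
    have "g (y k) = w * g (y (Suc k))"
      by (subst y(3)) (simp add: g.add zero[OF y(2)] gU)
    with Suc show ?case
      by (simp add: eigenfunctional_pow[of g, OF gU] gU mult_ac)
  qed (simp add: y(1))
  moreover have "(\<lambda>k. g ((U ^^ k) (y k))) \<longlonglongrightarrow> g 0"
    by (rule g.tendsto[OF wold_tail[of e y, OF y(2,3)]])
  ultimately have "(\<lambda>k::nat. g x) \<longlonglongrightarrow> 0"
    by (simp only: g.zero)
  then show False
    using \<open>g x \<noteq> 0\<close> by (simp only: LIMSEQ_const_iff)
qed

text \<open>Apply \<open>g\<close> to the finite Wold expansion. The tail contributes
  \<open>w ^ N * g (y N)\<close>, which tends to 0 because the remainders stay bounded; thus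
  \<open>g\<close> of the vector is a power series in \<open>w\<close>.\<close>

lemma eigenfunctional_sums:
  assumes g: "bounded_functional g" and gU: "\<And>x. g (U x) = w * g x" and w: "cmod w < 1"
    and y: "\<And>k. e k \<in> wandering" "\<And>k. y k = e k + U (y (Suc k))"
  shows "(\<lambda>k. g (e k) * w ^ k) sums g (y 0)"
proof -
  interpret g: bounded_linear g
    using g by (auto simp: bounded_functional_def)
  obtain K where K: "0 \<le> K" "\<And>x. cmod (g x) \<le> norm x * K"
    using g.nonneg_bounded by blast
  have step: "g (y k) = g (e k) + w * g (y (Suc k))" for k
    by (subst y(2)) (simp add: g.add gU)
  have partial: "(\<Sum>k<N. g (e k) * w ^ k) = g (y 0) - w ^ N * g (y N)" for N
  proof (induction N)
    case (Suc N)
    then show ?case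
      using step[of N] by (simp add: algebra_simps)
  qed simp
  have "(\<lambda>N. w ^ N * g (y N)) \<longlonglongrightarrow> 0"
  proof (rule Lim_null_comparison)
    show "eventually (\<lambda>N. cmod (w ^ N * g (y N)) \<le> cmod w ^ N * (norm (y 0) * K)) sequentially"
    proof (intro always_eventually allI)
      fix N
      have "cmod (g (y N)) \<le> norm (y N) * K"
        by (rule K)
      also have "\<dots> \<le> norm (y 0) * K"
        by (intro mult_right_mono K wold_norms[of e] y)
      finally show "cmod (w ^ N * g (y N)) \<le> cmod w ^ N * (norm (y 0) * K)"
        by (simp add: norm_mult norm_power mult_left_mono)
    qed
    show "(\<lambda>N. cmod w ^ N * (norm (y 0) * K)) \<longlonglongrightarrow> 0"
      using w by (intro tendsto_mult_left_zero LIMSEQ_realpow_zero) auto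
  qed
  then have "(\<lambda>N. g (y 0) - w ^ N * g (y N)) \<longlonglongrightarrow> g (y 0) - 0"
    by (intro tendsto_intros)
  then show ?thesis
    by (simp add: sums_def partial)
qed

section \<open>Finite multiplicity and holomorphic symbols\<close>

text \<open>Finite codimension of the range bounds the dimension of its orthogonal complement:
  replacing a finite spanning set modulo the range by the wandering parts \<open>q b\<close> spans
  \<open>wandering\<close>, since a wandering vector that lies in the range is orthogonal to itself.
  Gram-Schmidt then yields the basis.\<close>

lemma wandering_basis:
  assumes "finite_codim (range U)"
  obtains d :: nat and b where "\<And>l. l < d \<Longrightarrow> norm (b l) = 1"
    "\<And>v. v \<in> wandering \<Longrightarrow> v = (\<Sum>l<d. cinner v (b l) *\<^sub>C b l)"
proof -
  obtain B where B: "finite B" "\<And>v. \<exists>b\<in>complex_vector.span B. v - b \<in> range U"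
    using assms by (auto simp: finite_codim_def)
  obtain L where L: "\<And>x. x - U (L x) \<in> wandering"
    using wandering_decomposition by metis
  define q where "q x = x - U (L x)" for x
  have sub: "complex_vector.subspace (range U)"
    using assms by (simp add: finite_codim_def)
  have span: "wandering \<subseteq> complex_vector.span (q ` B)"
  proof
    fix v assume v: "v \<in> wandering"
    \<comment> \<open>Here \<open>q\<close> comes from a choice function, so the induction uses only
      that \<open>b - q b\<close> lies in the range of \<open>U\<close>, not linearity of
      \<open>q\<close>.\<close>
    have *: "\<exists>u\<in>complex_vector.span (q ` B). b - u \<in> range U" if "b \<in> complex_vector.span B" for b
      using that
    proof (induction b rule: complex_vector.span_induct_alt)
      case base
      show ?case
        by (rule bexI[of _ 0])
          (use sub complex_vector.subspace_0 in \<open>auto simp: complex_vector.span_zero\<close>)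
    next
      case (step c b z)
      then obtain u where u: "u \<in> complex_vector.span (q ` B)" "z - u \<in> range U"
        by blast
      have "b - q b \<in> range U"
        by (simp add: q_def)
      then have "c *\<^sub>C (b - q b) + (z - u) \<in> range U"
        using u sub by (intro complex_vector.subspace_add complex_vector.subspace_scale)
      moreover have "c *\<^sub>C (b - q b) + (z - u) = (c *\<^sub>C b + z) - (c *\<^sub>C q b + u)"
        by (simp add: complex_vector.scale_right_diff_distrib)
      ultimately show ?case
        using u step(1)
        by (intro bexI[of _ "c *\<^sub>C q b + u"] complex_vector.span_add complex_vector.span_scale)
          (auto intro: complex_vector.span_base)
    qed
    obtain b where b: "b \<in> complex_vector.span B" "v - b \<in> range U"
      using B by blast
    obtain u where u: "u \<in> complex_vector.span (q ` B)" "b - u \<in> range U"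
      using * b by blast
    have "u \<in> wandering"
      using u(1) complex_vector.span_minimal[of "q ` B" wandering] L subspace_wandering
      by (auto simp: q_def)
    then have "v - u \<in> wandering"
      using v subspace_wandering complex_vector.subspace_diff by blast
    moreover have "(v - b) + (b - u) \<in> range U"
      using b u sub complex_vector.subspace_add by blast
    then obtain x where x: "v - u = U x"
      by auto
    ultimately have "inner (v - u) (U x) = 0"
      by (simp add: wandering_def)
    then have "v - u = 0"
      unfolding x[symmetric] by simp
    then show "v \<in> complex_vector.span (q ` B)"
      using u by simp
  qed
  obtain d :: nat and b where
    basis: "(\<forall>i<d. \<forall>j<d. cinner (b i) (b j) = (if i = j then 1 else 0)) \<and>
     (\<forall>v\<in>q ` B. v = (\<Sum>l<d. cinner v (b l) *\<^sub>C b l))"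
    using finite_orthonormal_expansion[OF finite_imageI[OF B(1)], of q] by (elim exE) (rule that)
  note on = basis[THEN conjunct1] and exp = basis[THEN conjunct2]
  show ?thesis
  proof
    show "norm (b l) = 1" if "l < d" for l
    proof -
      have "complex_of_real ((norm (b l))\<^sup>2) = of_real 1"
        unfolding cinner_self[symmetric] using on that by simp
      then have "(norm (b l))\<^sup>2 = 1"
        unfolding of_real_eq_iff .
      then show ?thesis
        by (simp add: power2_eq_1_iff) (metis norm_ge_zero not_one_le_zero neg_0_le_iff_le)
    qed
    show "v = (\<Sum>l<d. cinner v (b l) *\<^sub>C b l)" if "v \<in> wandering" for v
    proof (rule span_orthonormal_expansion[of "q ` B"])
      show "u = (\<Sum>l<d. cinner u (b l) *\<^sub>C b l)" if "u \<in> q ` B" for u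
        using exp that by (rule bspec)
      show "v \<in> complex_vector.span (q ` B)"
        using span that by (rule subsetD)
    qed
  qed
qed

text \<open>Expanding every Wold coefficient \<open>e k\<close> of \<open>x\<close> in the basis and
  regrouping the series for \<open>g x\<close> leaves power series \<open>h l\<close> that depend on
  \<open>x\<close> but not on \<open>g\<close>. Their coefficients are bounded by the norm of
  \<open>x\<close>, so they converge on the unit disc: they are the coordinates of \<open>x\<close>
  in the shift model.\<close>

lemma holomorphic_symbol:
  fixes d :: nat
  assumes b: "\<And>l. l < d \<Longrightarrow> norm (b l) = 1"
    and basis: "\<And>v. v \<in> wandering \<Longrightarrow> v = (\<Sum>l<d. cinner v (b l) *\<^sub>C b l)"
  shows "\<exists>h. (\<forall>l<d. h l holomorphic_on ball 0 1) \<and>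
    (\<forall>g w. bounded_functional g \<and> (\<forall>x. g (U x) = w * g x) \<and> cmod w < 1 \<longrightarrow>
       g x = (\<Sum>l<d. h l w * g (b l)))"
proof -
  obtain e y where y: "y 0 = x" "\<And>k. e k \<in> wandering" "\<And>k. y k = e k + U (y (Suc k))"
    by (rule wold_expansion[of x]) (rule that)
  define h where "h l w = (\<Sum>k. cinner (e k) (b l) * w ^ k)" for l w
  have summable: "(\<lambda>k. cinner (e k) (b l) * w ^ k) sums h l w" if "l < d" "cmod w < 1" for l w
  proof -
    have "cmod (cinner (e k) (b l)) \<le> norm x" for k
      using norm_cinner_le[of "e k" "b l"] b[OF that(1)] wold_norms(1)[of e y k, OF y(2,3)] y(1) by simp
    then have "norm (cinner (e k) (b l) * w ^ k) \<le> norm x * cmod w ^ k" for k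
      by (simp add: norm_mult norm_power mult_right_mono)
    moreover have "summable (\<lambda>k. norm x * cmod w ^ k)"
      using that by (intro summable_mult summable_geometric) auto
    ultimately have "summable (\<lambda>k. cinner (e k) (b l) * w ^ k)"
      by (blast intro: summable_comparison_test')
    then show ?thesis
      by (simp add: h_def summable_sums)
  qed
  have holo: "h l holomorphic_on ball 0 1" if "l < d" for l
    by (rule power_series_holomorphic) (use summable[OF that] in simp)
  have expand: "g x = (\<Sum>l<d. h l w * g (b l))"
    if g: "bounded_functional g" and gU: "\<forall>x. g (U x) = w * g x" and w: "cmod w < 1" for g w
  proof (rule sums_unique2)
    have lin: "bounded_linear g" and scaleC: "\<And>c x. g (c *\<^sub>C x) = c * g x"
      using g by (auto simp: bounded_functional_def)
    show "(\<lambda>k. g (e k) * w ^ k) sums g x"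
      using eigenfunctional_sums[of g w e y, OF g spec[OF gU] w y(2,3)] unfolding y(1) .
    have "g (e k) = (\<Sum>l<d. cinner (e k) (b l) * g (b l))" for k
      using arg_cong[OF basis[OF y(2)[of k]], of g]
      by (simp only: linear_sum[OF bounded_linear.linear[OF lin]] scaleC)
    then have "g (e k) * w ^ k = (\<Sum>l<d. cinner (e k) (b l) * w ^ k * g (b l))" for k
      by (simp add: sum_distrib_left mult_ac)
    then show "(\<lambda>k. g (e k) * w ^ k) sums (\<Sum>l<d. h l w * g (b l))"
      using summable w by (auto intro!: sums_sum sums_mult2)
  qed
  show ?thesis
  proof (intro exI[of _ h] conjI allI impI)
    fix g w
    assume "bounded_functional g \<and> (\<forall>x. g (U x) = w * g x) \<and> cmod w < 1"
    then show "g x = (\<Sum>l<d. h l w * g (b l))"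
      by (elim conjE) (rule expand)
  qed (rule holo)
qed

text \<open>The functional is \<open>ev \<circ> q(U)\<close>, where \<open>p = (X - w) q\<close> is a polynomial of least degree with
  \<open>ev \<circ> p(U) = 0\<close>.\<close>

lemma eigenfunctional_exists:
  assumes ev: "bounded_functional ev" and nz: "ev x0 \<noteq> 0"
    and B: "finite B" "\<And>v. \<exists>b\<in>complex_vector.span B. v - b \<in> I"
    and I: "\<And>k v. v \<in> I \<Longrightarrow> ev ((U ^^ k) v) = 0"
  obtains n c w where "\<exists>x. (\<Sum>k\<le>n. c k * ev ((U ^^ k) x)) \<noteq> 0"
    "\<And>x. (\<Sum>k\<le>n. c k * ev ((U ^^ k) (U x))) = w * (\<Sum>k\<le>(n::nat). c k * ev ((U ^^ k) x))"
proof -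
  have lin_ev: "bounded_linear ev" and scaleC_ev: "\<And>c x. ev (c *\<^sub>C x) = c * ev x"
    using ev by (auto simp: bounded_functional_def)
  have U_pow_add: "(U ^^ k) (x + y) = (U ^^ k) x + (U ^^ k) y" for k x y
    by (rule linear_add[OF bounded_linear.linear[OF bounded_linear_U_pow]])
  \<comment> \<open>\<open>\<Lambda> p\<close> is the functional obtained by composing
    \<open>ev\<close> with \<open>p(U)\<close>.\<close>
  define \<Lambda> where "\<Lambda> p x = (\<Sum>k\<le>degree p. coeff p k * ev ((U ^^ k) x))" for p x
  have \<Lambda>: "\<Lambda> p x = (\<Sum>k\<le>n. coeff p k * ev ((U ^^ k) x))" if "degree p \<le> n" for p x n
    unfolding \<Lambda>_def using that
    by (intro sum.mono_neutral_left) (auto simp: coeff_eq_0)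
  have \<Lambda>_add: "\<Lambda> p (x + y) = \<Lambda> p x + \<Lambda> p y" for p x y
    by (simp add: \<Lambda>_def U_pow_add linear_add[OF bounded_linear.linear[OF lin_ev]]
        distrib_left sum.distrib)
  have \<Lambda>_scaleC: "\<Lambda> p (c *\<^sub>C x) = c * \<Lambda> p x" for p c x
    by (simp add: \<Lambda>_def U_pow_scaleC scaleC_ev sum_distrib_left mult_ac)
  \<comment> \<open>The functionals \<open>ev\<close> composed with \<open>U ^^ k\<close> vanish on
    \<open>I\<close>, so their values on \<open>B\<close> determine them. Taking
    \<open>card B + 1\<close> of them gives one more unknown coefficient than there are
    equations.\<close>
  have "\<exists>p. p \<noteq> 0 \<and> (\<forall>x. \<Lambda> p x = 0)"
  proof -
    obtain b where b: "B = b ` {..<card B}"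
      using B(1) finite_imp_nat_seg_image_inj_on[OF B(1)] card_image
      by (metis card_lessThan lessThan_def)
    obtain v where v: "\<exists>k\<le>card B. v k \<noteq> 0"
      "\<And>i. i < card B \<Longrightarrow> (\<Sum>k\<le>card B. ev ((U ^^ k) (b i)) * v k) = 0"
      using underdetermined_system[of "card B" "\<lambda>i k. ev ((U ^^ k) (b i))"] by blast
    define p where "p = (\<Sum>k\<le>card B. monom (v k) k)"
    have coeff_p: "coeff p k = (if k \<le> card B then v k else 0)" for k
      by (simp add: p_def coeff_sum)
    have "p \<noteq> 0"
      using v(1) coeff_p by (metis coeff_0)
    have "degree p \<le> card B"
      by (rule degree_le) (simp add: coeff_p)
    have on_B: "\<Lambda> p x = 0" if "x \<in> B" for x
    proof -
      obtain i where "i < card B" "x = b i"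
        using \<open>x \<in> B\<close> b by blast
      with v(2)[of i] show ?thesis
        by (simp add: \<Lambda>[OF \<open>degree p \<le> card B\<close>] coeff_p mult.commute)
    qed
    have on_span: "\<Lambda> p x = 0" if "x \<in> complex_vector.span B" for x
      using that
    proof (induction x rule: complex_vector.span_induct_alt)
      case base
      show ?case
        using \<Lambda>_add[of p 0 0] by simp
    next
      case (step c x y)
      then show ?case
        by (simp add: \<Lambda>_add \<Lambda>_scaleC on_B)
    qed
    have "\<Lambda> p x = 0" for x
    proof -
      obtain u where u: "u \<in> complex_vector.span B" "x - u \<in> I"
        using B(2) by blast
      have "\<Lambda> p (x - u) = 0"
        by (simp add: \<Lambda>_def I[OF u(2)])
      then show ?thesis
        using \<Lambda>_add[of p "x - u" u] on_span[OF u(1)] by simp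
    qed
    with \<open>p \<noteq> 0\<close> show ?thesis by blast
  qed
  then obtain p where p: "p \<noteq> 0" "\<And>x. \<Lambda> p x = 0"
    and min: "\<And>q. q \<noteq> 0 \<Longrightarrow> (\<And>x. \<Lambda> q x = 0) \<Longrightarrow> degree p \<le> degree q"
    using exists_least_iff[of "\<lambda>n. \<exists>p. degree p = n \<and> p \<noteq> 0 \<and> (\<forall>x. \<Lambda> p x = 0)"]
    by (metis not_le)
  \<comment> \<open>A nonzero constant polynomial would give a nonzero multiple of
    \<open>ev\<close>, which does not vanish at \<open>x0\<close>.\<close>
  have "degree p \<noteq> 0"
  proof
    assume "degree p = 0"
    then obtain a where "p = [:a:]"
      using degree_eq_zeroE by blast
    then show False
      using p nz by (auto simp: \<Lambda>_def)
  qed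
  then obtain w where "poly p w = 0"
    using fundamental_theorem_of_algebra[of p] by (auto simp: constant_degree)
  then obtain q where q: "p = [:- w, 1:] * q"
    by (auto simp: poly_eq_0_iff_dvd)
  then have "q \<noteq> 0"
    using p(1) by auto
  then have deg: "degree p = Suc (degree q)"
    unfolding q by (subst degree_mult_eq) auto
  \<comment> \<open>Multiplication by the variable shifts coefficients, and \<open>\<Lambda>\<close>
    turns this shift into precomposition with \<open>U\<close>; so \<open>\<Lambda> p x = 0\<close>
    reads as the eigenvalue equation for \<open>q\<close>.\<close>
  have "\<Lambda> q (U x) = w * \<Lambda> q x" for x
  proof -
    have coeff_p: "coeff p k = coeff (pCons 0 q) k - w * coeff q k" for k
      by (simp add: q)
    have "\<Lambda> p x = (\<Sum>k\<le>Suc (degree q). coeff p k * ev ((U ^^ k) x))"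
      by (rule \<Lambda>) (simp only: deg order_refl)
    also have "\<dots> = (\<Sum>k\<le>Suc (degree q). coeff (pCons 0 q) k * ev ((U ^^ k) x))
        - w * (\<Sum>k\<le>Suc (degree q). coeff q k * ev ((U ^^ k) x))"
      by (simp only: coeff_p left_diff_distrib sum_subtractf sum_distrib_left mult.assoc)
    also have "(\<Sum>k\<le>Suc (degree q). coeff q k * ev ((U ^^ k) x)) = \<Lambda> q x"
      by (rule \<Lambda>[symmetric]) simp
    also have "(\<Sum>k\<le>Suc (degree q). coeff (pCons 0 q) k * ev ((U ^^ k) x)) = \<Lambda> q (U x)"
      unfolding sum.atMost_Suc_shift by (simp add: \<Lambda>_def funpow_swap1)
    finally show ?thesis
      by (simp add: p(2))
  qed
  moreover have "\<exists>x. \<Lambda> q x \<noteq> 0"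
  proof (rule ccontr)
    assume "\<not> (\<exists>x. \<Lambda> q x \<noteq> 0)"
    then have "degree p \<le> degree q"
      by (intro min \<open>q \<noteq> 0\<close>) blast
    then show False
      by (simp add: deg)
  qed
  ultimately show ?thesis
    unfolding \<Lambda>_def by (intro that[of "coeff q" "degree q" w])
qed

end

section \<open>The algebra of the domain and the algebraic tensor product\<close>

lemma holo_on_const: "open V \<Longrightarrow> holo_on (\<lambda>_. c) V"
  unfolding holo_on_def by (intro conjI ballI exI[of _ "\<lambda>_. 0"]) simp_all

lemma holo_on_coordinate: "open V \<Longrightarrow> holo_on (\<lambda>z. vec_nth z i) V"
  unfolding holo_on_def
  by (auto intro!: exI[of _ "\<lambda>z. vec_nth z i"] bounded_linear_imp_has_derivative bounded_linear_vec_nth)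

lemma holo_on_add:
  assumes "holo_on f V" "holo_on g V"
  shows "holo_on (\<lambda>z. f z + g z) V"
proof -
  have "\<exists>D. ((\<lambda>z. f z + g z) has_derivative D) (at z) \<and> (\<forall>c v. D (c *s v) = c * D v)" if z: "z \<in> V" for z
  proof -
    obtain D E where "(f has_derivative D) (at z)" "\<forall>c v. D (c *s v) = c * D v"
      "(g has_derivative E) (at z)" "\<forall>c v. E (c *s v) = c * E v"
      using assms z unfolding holo_on_def by blast
    then show ?thesis
      by (intro exI[of _ "\<lambda>v. D v + E v"]) (auto intro: has_derivative_add simp: distrib_left)
  qed
  then show ?thesis
    using assms by (simp add: holo_on_def)
qed

lemma holo_on_mult:
  assumes "holo_on f V" "holo_on g V"
  shows "holo_on (\<lambda>z. f z * g z) V"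
proof -
  have "\<exists>D. ((\<lambda>z. f z * g z) has_derivative D) (at z) \<and> (\<forall>c v. D (c *s v) = c * D v)" if z: "z \<in> V" for z
  proof -
    obtain D E where "(f has_derivative D) (at z)" "\<forall>c v. D (c *s v) = c * D v"
      "(g has_derivative E) (at z)" "\<forall>c v. E (c *s v) = c * E v"
      using assms z unfolding holo_on_def by blast
    then show ?thesis
      by (intro exI[of _ "\<lambda>v. f z * E v + D v * g z"] conjI has_derivative_mult)
        (simp_all add: algebra_simps)
  qed
  then show ?thesis
    using assms by (simp add: holo_on_def)
qed

lemma holo_on_subset: "holo_on f V \<Longrightarrow> open W \<Longrightarrow> W \<subseteq> V \<Longrightarrow> holo_on f W"
  by (auto simp: holo_on_def)

lemma holo_on_sum:
  assumes "open V" "\<And>i. i \<in> I \<Longrightarrow> holo_on (f i) V"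
  shows "holo_on (\<lambda>z. \<Sum>i\<in>I. f i z) V"
  using assms(2)
  by (induction I rule: infinite_finite_induct) (auto intro: holo_on_add holo_on_const assms(1))

lemma holo_on_prod:
  assumes "open V" "\<And>i. i \<in> I \<Longrightarrow> holo_on (f i) V"
  shows "holo_on (\<lambda>z. \<Prod>i\<in>I. f i z) V"
  using assms(2)
  by (induction I rule: infinite_finite_induct) (auto intro: holo_on_mult holo_on_const assms(1))

lemma holo_on_power: "open V \<Longrightarrow> holo_on f V \<Longrightarrow> holo_on (\<lambda>z. f z ^ k) V"
  by (induction k) (auto intro: holo_on_mult holo_on_const)

lemma restrict0_apply: "z \<in> \<Omega> \<Longrightarrow> restrict0 \<Omega> f z = f z"
  by (simp add: restrict0_def)

lemma restrict0_in_A_alg: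
  assumes "holo_on f UNIV"
  shows "restrict0 \<Omega> f \<in> A_alg \<Omega>"
proof -
  have "\<exists>g V. closure \<Omega> \<subseteq> V \<and> holo_on g V \<and> (\<forall>z\<in>\<Omega>. cmod (restrict0 \<Omega> f z - g z) < e)" if "e > 0" for e
    using assms that by (intro exI[of _ f] exI[of _ UNIV]) (simp add: restrict0_def)
  moreover have "restrict0 \<Omega> (restrict0 \<Omega> f) = restrict0 \<Omega> f"
    by (auto simp: restrict0_def)
  ultimately show ?thesis
    by (simp add: A_alg_def)
qed

lemma poly_funs_in_A_alg:
  assumes "p \<in> poly_funs"
  shows "restrict0 \<Omega> p \<in> A_alg \<Omega>"
proof -
  obtain S c where p: "p = (\<lambda>z. \<Sum>\<alpha>\<in>S. c \<alpha> * (\<Prod>i\<in>UNIV. (vec_nth z i) ^ \<alpha> i))"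
    using assms by (auto simp: poly_funs_def)
  show ?thesis
    unfolding p by (intro restrict0_in_A_alg holo_on_sum holo_on_mult holo_on_prod holo_on_power
      holo_on_const holo_on_coordinate open_UNIV)
qed

text \<open>An approximant within distance 1 is continuous on the compact closure of the domain,
  hence bounded there.\<close>

lemma A_alg_bounded:
  assumes "bounded \<Omega>" "f \<in> A_alg \<Omega>"
  obtains M where "M > 0" "\<And>z. z \<in> \<Omega> \<Longrightarrow> cmod (f z) \<le> M"
proof -
  obtain g V where g: "closure \<Omega> \<subseteq> V" "holo_on g V" "\<And>z. z \<in> \<Omega> \<Longrightarrow> cmod (f z - g z) < 1"
    using assms(2) unfolding A_alg_def by (force dest: spec[of _ 1])
  have "continuous_on (closure \<Omega>) g"
    using g(1,2) unfolding holo_on_def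
    by (intro continuous_at_imp_continuous_on) (blast intro: has_derivative_continuous)
  then have "bounded (g ` closure \<Omega>)"
    using assms(1) by (intro compact_imp_bounded compact_continuous_image) (simp_all add: compact_closure)
  then obtain K where K: "K > 0" "\<And>z. z \<in> closure \<Omega> \<Longrightarrow> cmod (g z) \<le> K"
    by (auto simp: bounded_pos)
  show ?thesis
  proof
    show "cmod (f z) \<le> K + 1" if "z \<in> \<Omega>" for z
      using g(3)[OF that] K(2)[of z] that closure_subset[of \<Omega>] norm_triangle_sub[of "f z" "g z"] by force
  qed (use K in simp)
qed

lemma A_alg_mult:
  assumes "bounded \<Omega>" and f: "f \<in> A_alg \<Omega>" and h: "h \<in> A_alg \<Omega>"
  shows "(\<lambda>z. f z * h z) \<in> A_alg \<Omega>"
proof -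
  obtain M where M: "M > 0" "\<And>z. z \<in> \<Omega> \<Longrightarrow> cmod (f z) \<le> M"
    using A_alg_bounded[OF assms(1) f] by blast
  obtain N where N: "N > 0" "\<And>z. z \<in> \<Omega> \<Longrightarrow> cmod (h z) \<le> N"
    using A_alg_bounded[OF assms(1) h] by blast
  have "\<exists>g V. closure \<Omega> \<subseteq> V \<and> holo_on g V \<and> (\<forall>z\<in>\<Omega>. cmod (f z * h z - g z) < e)" if "e > 0" for e
  proof -
    \<comment> \<open>The cap 1 in \<open>e1\<close> keeps the approximant \<open>q\<close> below
      \<open>N + 1\<close>; each of the two error terms of the product then costs at most
      \<open>e / 2\<close>.\<close>
    define e1 where "e1 = min 1 (e / (2 * M))"
    define e2 where "e2 = e / (2 * (N + 1))"
    have e12: "e1 > 0" "e2 > 0" "M * e1 \<le> e / 2" "(N + 1) * e2 = e / 2"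
      using M(1) N(1) that by (auto simp: e1_def e2_def min_def field_simps)
    obtain p V where p: "closure \<Omega> \<subseteq> V" "holo_on p V" "\<And>z. z \<in> \<Omega> \<Longrightarrow> cmod (f z - p z) < e2"
      using f e12(2) unfolding A_alg_def by auto
    obtain q W where q: "closure \<Omega> \<subseteq> W" "holo_on q W" "\<And>z. z \<in> \<Omega> \<Longrightarrow> cmod (h z - q z) < e1"
      using h e12(1) unfolding A_alg_def by auto
    have VW: "open (V \<inter> W)"
      using p(2) q(2) by (auto simp: holo_on_def)
    have "cmod (f z * h z - p z * q z) < e" if z: "z \<in> \<Omega>" for z
    proof -
      have qz: "cmod (q z) \<le> N + 1"
        using q(3)[OF z] N(2)[OF z] norm_triangle_sub[of "q z" "h z"]
        by (simp add: e1_def norm_minus_commute)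
      have "f z * h z - p z * q z = f z * (h z - q z) + (f z - p z) * q z"
        by (simp add: algebra_simps)
      then have "cmod (f z * h z - p z * q z) \<le> cmod (f z) * cmod (h z - q z) + cmod (f z - p z) * cmod (q z)"
        by (metis norm_mult norm_triangle_ineq)
      also have "\<dots> \<le> M * cmod (h z - q z) + cmod (f z - p z) * (N + 1)"
        using M(1) M(2)[OF z] qz by (intro add_mono mult_mono) auto
      also have "\<dots> < M * e1 + e2 * (N + 1)"
        using M(1) N(1) p(3)[OF z] q(3)[OF z] by (intro add_strict_mono mult_strict_left_mono mult_strict_right_mono) auto
      also have "\<dots> \<le> e"
        using e12 by (simp add: mult.commute)
      finally show ?thesis .
    qed
    moreover have "holo_on (\<lambda>z. p z * q z) (V \<inter> W)"
      using p(2) q(2) VW by (intro holo_on_mult) (auto intro: holo_on_subset)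
    ultimately show ?thesis
      using p(1) q(1) by (intro exI[of _ "\<lambda>z. p z * q z"] exI[of _ "V \<inter> W"]) auto
  qed
  moreover have "restrict0 \<Omega> (\<lambda>z. f z * h z) = (\<lambda>z. f z * h z)"
  proof -
    have f0: "restrict0 \<Omega> f = f"
      using f unfolding A_alg_def by blast
    have "f z = 0" if "z \<notin> \<Omega>" for z
      using fun_cong[OF f0, of z] that by (simp add: restrict0_def)
    then show ?thesis
      by (auto simp: restrict0_def)
  qed
  ultimately show ?thesis
    by (simp add: A_alg_def)
qed

section \<open>Square-summable sequences and the algebraic tensor product\<close>

lemma ell2_zero: "(\<lambda>_. 0) \<in> ell2 m"
  by (simp add: ell2_def)

lemma ell2_scale: "x \<in> ell2 m \<Longrightarrow> (\<lambda>k. c * x k) \<in> ell2 m"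
  by (auto simp: ell2_def norm_mult power_mult_distrib intro: summable_mult)

lemma ell2_add:
  assumes "x \<in> ell2 m" "y \<in> ell2 m"
  shows "(\<lambda>k. x k + y k) \<in> ell2 m"
proof -
  have "summable (\<lambda>k. 2 * (cmod (x k))\<^sup>2 + 2 * (cmod (y k))\<^sup>2)"
    using assms by (intro summable_add summable_mult) (auto simp: ell2_def)
  moreover have "norm ((cmod (x k + y k))\<^sup>2) \<le> 2 * (cmod (x k))\<^sup>2 + 2 * (cmod (y k))\<^sup>2" for k
  proof -
    have "(cmod (x k + y k))\<^sup>2 \<le> (cmod (x k) + cmod (y k))\<^sup>2"
      by (intro power_mono norm_triangle_ineq) auto
    also have "\<dots> \<le> 2 * (cmod (x k))\<^sup>2 + 2 * (cmod (y k))\<^sup>2"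
      using sum_squares_bound[of "cmod (x k)" "cmod (y k)"] by (simp add: power2_sum)
    finally show ?thesis by simp
  qed
  ultimately have "summable (\<lambda>k. (cmod (x k + y k))\<^sup>2)"
    by (rule summable_comparison_test'[where N = 0])
  then show ?thesis
    using assms by (auto simp: ell2_def)
qed

lemma ell2_sum: "(\<And>i. i \<in> I \<Longrightarrow> x i \<in> ell2 m) \<Longrightarrow> (\<lambda>k. \<Sum>i\<in>I. x i k) \<in> ell2 m"
  by (induction I rule: infinite_finite_induct) (auto intro: ell2_add ell2_zero)

lemma norm_component_le_ell2_norm:
  assumes "x \<in> ell2 m"
  shows "cmod (x k) \<le> ell2_norm x"
proof -
  have "(\<Sum>i\<in>{k}. (cmod (x i))\<^sup>2) \<le> (\<Sum>i. (cmod (x i))\<^sup>2)"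
    using assms by (intro sum_le_suminf) (auto simp: ell2_def)
  then show ?thesis
    unfolding ell2_norm_def by (intro real_le_rsqrt) simp
qed

lemma alg_tensor_in_ell2:
  assumes "F \<in> alg_tensor \<Omega> m"
  shows "F z \<in> ell2 m"
proof -
  obtain N \<theta> x where F: "\<forall>i<N. \<theta> i \<in> A_alg \<Omega> \<and> x i \<in> ell2 m" "F = (\<lambda>z k. \<Sum>i<(N::nat). \<theta> i z * x i k)"
    using assms unfolding alg_tensor_def by blast
  have "(\<lambda>k. \<Sum>i<N. \<theta> i z * x i k) \<in> ell2 m"
    by (rule ell2_sum, rule ell2_scale) (use F(1) in simp)
  then show ?thesis
    by (simp add: F(2))
qed

lemma alg_tensor_add:
  assumes "F \<in> alg_tensor \<Omega> m" "G \<in> alg_tensor \<Omega> m"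
  shows "(\<lambda>z k. F z k + G z k) \<in> alg_tensor \<Omega> m"
proof -
  obtain N \<theta> x where F: "\<forall>i<N. \<theta> i \<in> A_alg \<Omega> \<and> x i \<in> ell2 m" "F = (\<lambda>z k. \<Sum>i<(N::nat). \<theta> i z * x i k)"
    using assms(1) unfolding alg_tensor_def by blast
  obtain M \<eta> y where G: "\<forall>i<M. \<eta> i \<in> A_alg \<Omega> \<and> y i \<in> ell2 m" "G = (\<lambda>z k. \<Sum>i<(M::nat). \<eta> i z * y i k)"
    using assms(2) unfolding alg_tensor_def by blast
  define \<theta>' where "\<theta>' i = (if i < N then \<theta> i else \<eta> (i - N))" for i
  define x' where "x' i = (if i < N then x i else y (i - N))" for i
  have "(\<Sum>i<N + M. \<theta>' i z * x' i k) = (\<Sum>i<N. \<theta>' i z * x' i k) + (\<Sum>i<M. \<theta>' (N + i) z * x' (N + i) k)" for z k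
    by (induction M) (simp_all add: algebra_simps)
  then have "(\<lambda>z k. F z k + G z k) = (\<lambda>z k. \<Sum>i<N + M. \<theta>' i z * x' i k)"
    by (simp add: F(2) G(2) \<theta>'_def x'_def)
  moreover have "\<forall>i<N + M. \<theta>' i \<in> A_alg \<Omega> \<and> x' i \<in> ell2 m"
    using F(1) G(1) by (auto simp: \<theta>'_def x'_def)
  ultimately show ?thesis
    unfolding alg_tensor_def by blast
qed

lemma alg_tensor_scale:
  assumes "F \<in> alg_tensor \<Omega> m"
  shows "(\<lambda>z k. c * F z k) \<in> alg_tensor \<Omega> m"
proof -
  obtain N \<theta> x where F: "\<forall>i<N. \<theta> i \<in> A_alg \<Omega> \<and> x i \<in> ell2 m" "F = (\<lambda>z k. \<Sum>i<(N::nat). \<theta> i z * x i k)"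
    using assms unfolding alg_tensor_def by blast
  have "(\<lambda>z k. c * F z k) = (\<lambda>z k. \<Sum>i<N. \<theta> i z * (c * x i k))"
    by (simp add: F(2) sum_distrib_left mult_ac)
  moreover have "\<forall>i<N. \<theta> i \<in> A_alg \<Omega> \<and> (\<lambda>k. c * x i k) \<in> ell2 m"
    using F(1) by (auto intro: ell2_scale)
  ultimately show ?thesis
    unfolding alg_tensor_def
    by (intro CollectI exI[of _ N] exI[of _ \<theta>] exI[of _ "\<lambda>i k. c * x i k"]) simp
qed

lemma alg_tensor_mult:
  assumes "bounded \<Omega>" "\<phi> \<in> A_alg \<Omega>" "F \<in> alg_tensor \<Omega> m"
  shows "(\<lambda>z k. \<phi> z * F z k) \<in> alg_tensor \<Omega> m"
proof -
  obtain N \<theta> x where F: "\<forall>i<N. \<theta> i \<in> A_alg \<Omega> \<and> x i \<in> ell2 m" "F = (\<lambda>z k. \<Sum>i<(N::nat). \<theta> i z * x i k)"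
    using assms(3) unfolding alg_tensor_def by blast
  have "(\<lambda>z k. \<phi> z * F z k) = (\<lambda>z k. \<Sum>i<N. (\<phi> z * \<theta> i z) * x i k)"
    by (simp add: F(2) sum_distrib_left mult_ac)
  moreover have "\<forall>i<N. (\<lambda>z. \<phi> z * \<theta> i z) \<in> A_alg \<Omega> \<and> x i \<in> ell2 m"
    using F(1) assms by (auto intro: A_alg_mult)
  ultimately show ?thesis
    unfolding alg_tensor_def by (intro CollectI exI[of _ N] exI[of _ "\<lambda>i z. \<phi> z * \<theta> i z"] exI[of _ x]) simp
qed

section \<open>Evaluation functionals\<close>

lemma bounded_functionalI:
  assumes "\<And>x y. g (x + y) = g x + g y" "\<And>c x. g (c *\<^sub>C x) = c * g x" "\<And>x. cmod (g x) \<le> norm x * K"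
  shows "bounded_functional g"
  unfolding bounded_functional_def
  using assms by (auto intro!: bounded_linear_intro[of _ K] simp: scaleR_scaleC scaleR_conv_of_real)

text \<open>The functional is evaluation at \<open>z\<close> followed by the coordinate of index 0.
  Boundedness of evaluation makes it Lipschitz on the dense image of the tensor product, so it
  extends continuously to the whole space, and the algebraic identities pass to limits.\<close>

lemma evaluation_functional:
  fixes act :: "(complex ^ 'n \<Rightarrow> complex) \<Rightarrow> 'h \<Rightarrow> 'h::chilbert_space"
  assumes M: "hilbert_module \<Omega> act" and qf: "quasi_free_completion \<Omega> act m \<iota>" and m: "m \<ge> 1"
    and "bounded \<Omega>" and z: "z \<in> \<Omega>"
  obtains ev where "bounded_functional ev" "\<exists>x. ev x \<noteq> 0"
    "\<And>\<phi> x. \<phi> \<in> A_alg \<Omega> \<Longrightarrow> ev (act \<phi> x) = \<phi> z * ev x"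
proof -
  interpret hilbert_module \<Omega> act by (rule M)
  define T where "T = alg_tensor \<Omega> m"
  have \<iota>_add: "\<iota> (\<lambda>z k. F z k + G z k) = \<iota> F + \<iota> G" if "F \<in> T" "G \<in> T" for F G
    using qf that unfolding quasi_free_completion_def T_def Let_def by blast
  have \<iota>_scale: "\<iota> (\<lambda>z k. c * F z k) = c *\<^sub>C \<iota> F" if "F \<in> T" for c F
    using qf that unfolding quasi_free_completion_def T_def Let_def by blast
  have inj: "inj_on \<iota> T" and dense: "closure (\<iota> ` T) = UNIV"
    using qf unfolding quasi_free_completion_def T_def Let_def by blast+
  have \<iota>_act: "act \<phi> (\<iota> F) = \<iota> (\<lambda>z k. \<phi> z * F z k)" if "\<phi> \<in> A_alg \<Omega>" "F \<in> T" for \<phi> F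
    using qf that unfolding quasi_free_completion_def T_def Let_def by blast
  have "\<exists>C. \<forall>F\<in>T. ell2_norm (F z) \<le> C * norm (\<iota> F)"
    using qf z unfolding quasi_free_completion_def T_def Let_def by blast
  then obtain C where C: "\<And>F. F \<in> T \<Longrightarrow> ell2_norm (F z) \<le> C * norm (\<iota> F)"
    by blast
  have bound: "cmod (F z 0) \<le> \<bar>C\<bar> * norm (\<iota> F)" if "F \<in> T" for F
  proof -
    have "cmod (F z 0) \<le> ell2_norm (F z)"
      using that unfolding T_def by (intro norm_component_le_ell2_norm alg_tensor_in_ell2)
    also have "\<dots> \<le> C * norm (\<iota> F)"
      by (rule C[OF that])
    also have "\<dots> \<le> \<bar>C\<bar> * norm (\<iota> F)"
      by (intro mult_right_mono) auto
    finally show ?thesis .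
  qed
  \<comment> \<open>Outside the image of \<open>T\<close> the value of \<open>inv_into\<close> is
    arbitrary; \<open>f\<close> is only evaluated on the image.\<close>
  define f where "f x = inv_into T \<iota> x z 0" for x
  have f: "f (\<iota> F) = F z 0" if "F \<in> T" for F
    using inv_into_f_f[OF inj that] by (simp add: f_def)
  have "dist (f x) (f y) \<le> \<bar>C\<bar> * dist x y" if "x \<in> \<iota> ` T" "y \<in> \<iota> ` T" for x y
  proof -
    obtain F G where FG: "F \<in> T" "G \<in> T" "x = \<iota> F" "y = \<iota> G"
      using \<open>x \<in> \<iota> ` T\<close> \<open>y \<in> \<iota> ` T\<close> by blast
    have G': "(\<lambda>z k. (-1) * G z k) \<in> T"
      using FG unfolding T_def by (intro alg_tensor_scale)
    then have D: "(\<lambda>z k. F z k + (-1) * G z k) \<in> T"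
      using FG unfolding T_def by (intro alg_tensor_add)
    have "\<iota> (\<lambda>z k. F z k + (-1) * G z k) = x - y"
      using \<iota>_add[OF FG(1) G'] \<iota>_scale[OF FG(2), of "-1"] FG
      by (simp add: complex_vector.scale_minus_left scaleC_one)
    then show ?thesis
      using bound[OF D] FG by (simp add: f dist_norm)
  qed
  then have "\<bar>C\<bar>-lipschitz_on (\<iota> ` T) f"
    by (intro lipschitz_onI) auto
  then have "uniformly_continuous_on (\<iota> ` T) f"
    by (rule lipschitz_on_uniformly_continuous)
  then obtain ev where ev: "uniformly_continuous_on (closure (\<iota> ` T)) ev"
    "\<And>x. x \<in> \<iota> ` T \<Longrightarrow> f x = ev x"
    by (rule uniformly_continuous_on_extension_on_closure) blast
  have ev_\<iota>: "ev (\<iota> F) = F z 0" if "F \<in> T" for F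
    using ev(2)[of "\<iota> F"] f[OF that] that by simp
  have "isCont ev x" for x
    using uniformly_continuous_imp_continuous[OF ev(1)] by (simp add: dense continuous_on_eq_continuous_at)
  then have lim: "(\<lambda>n. ev (s n)) \<longlonglongrightarrow> ev x" if "s \<longlonglongrightarrow> x" for s :: "nat \<Rightarrow> 'h" and x
    using that by (rule isCont_tendsto_compose)
  have approx: "\<exists>F. (\<forall>n. F n \<in> T) \<and> (\<lambda>n. \<iota> (F n)) \<longlonglongrightarrow> x" for x
  proof -
    obtain s where "\<forall>n. s n \<in> \<iota> ` T" "s \<longlonglongrightarrow> x"
      using dense closure_sequential[of x "\<iota> ` T"] by auto
    moreover from this(1) have "\<forall>n. \<exists>F. F \<in> T \<and> s n = \<iota> F"
      by blast
    then obtain F where F: "\<forall>n. F n \<in> T \<and> s n = \<iota> (F n)"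
      by (rule choice[THEN exE])
    moreover from F have "s = (\<lambda>n. \<iota> (F n))"
      by (intro ext) simp
    ultimately show ?thesis
      by (intro exI[of _ F]) simp
  qed
  have act_lim: "(\<lambda>n. act \<phi> (s n)) \<longlonglongrightarrow> act \<phi> x" if \<phi>: "\<phi> \<in> A_alg \<Omega>" and s: "s \<longlonglongrightarrow> x" for \<phi> s x
  proof -
    have le: "norm (act \<phi> (s n) - act \<phi> x) \<le> sup_norm \<Omega> \<phi> * norm (s n - x)" for n
      using act_add_right[OF \<phi>, of "s n - x" x] act_contractive[OF \<phi>, of "s n - x"] by simp
    have "(\<lambda>n. sup_norm \<Omega> \<phi> * norm (s n - x)) \<longlonglongrightarrow> 0"
      using s by (intro tendsto_mult_right_zero tendsto_norm_zero) (simp add: LIM_zero)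
    then have "(\<lambda>n. act \<phi> (s n) - act \<phi> x) \<longlonglongrightarrow> 0"
      by (rule Lim_null_comparison[rotated]) (simp add: le)
    then show ?thesis
      by (rule LIM_zero_cancel)
  qed
  have scale_lim: "(\<lambda>n. c *\<^sub>C s n) \<longlonglongrightarrow> c *\<^sub>C x" if s: "s \<longlonglongrightarrow> x" for c and s :: "nat \<Rightarrow> 'h" and x
  proof (rule LIM_zero_cancel, rule tendsto_norm_zero_cancel)
    have "(\<lambda>n. cmod c * norm (s n - x)) \<longlonglongrightarrow> 0"
      using s by (intro tendsto_mult_right_zero tendsto_norm_zero) (simp add: LIM_zero)
    then show "(\<lambda>n. norm (c *\<^sub>C s n - c *\<^sub>C x)) \<longlonglongrightarrow> 0"
      by (simp add: norm_scaleC flip: complex_vector.scale_right_diff_distrib)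
  qed
  show ?thesis
  proof
    show "bounded_functional ev"
    proof (rule bounded_functionalI)
      fix x y c
      obtain F where F: "\<And>n. F n \<in> T" "(\<lambda>n. \<iota> (F n)) \<longlonglongrightarrow> x"
        using approx by blast
      obtain G where G: "\<And>n. G n \<in> T" "(\<lambda>n. \<iota> (G n)) \<longlonglongrightarrow> y"
        using approx by blast
      have FG: "ev (\<iota> (F n) + \<iota> (G n)) = ev (\<iota> (F n)) + ev (\<iota> (G n))" for n
      proof -
        have "(\<lambda>z k. F n z k + G n z k) \<in> T"
          using F(1) G(1) unfolding T_def by (intro alg_tensor_add)
        from ev_\<iota>[OF this] show ?thesis
          by (simp add: \<iota>_add F(1) G(1) ev_\<iota>)
      qed
      have "(\<lambda>n. ev (\<iota> (F n) + \<iota> (G n))) \<longlonglongrightarrow> ev (x + y)"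
        by (intro lim tendsto_add F G)
      moreover have "(\<lambda>n. ev (\<iota> (F n) + \<iota> (G n))) \<longlonglongrightarrow> ev x + ev y"
        unfolding FG by (intro tendsto_add lim F G)
      ultimately show "ev (x + y) = ev x + ev y"
        by (rule LIMSEQ_unique)
      have cF: "ev (c *\<^sub>C \<iota> (F n)) = c * ev (\<iota> (F n))" for n
      proof -
        have "(\<lambda>z k. c * F n z k) \<in> T"
          using F(1) unfolding T_def by (intro alg_tensor_scale)
        from ev_\<iota>[OF this] show ?thesis
          by (simp add: \<iota>_scale F(1) ev_\<iota>)
      qed
      have "(\<lambda>n. ev (c *\<^sub>C \<iota> (F n))) \<longlonglongrightarrow> ev (c *\<^sub>C x)"
        by (intro lim scale_lim F)
      moreover have "(\<lambda>n. ev (c *\<^sub>C \<iota> (F n))) \<longlonglongrightarrow> c * ev x"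
        unfolding cF by (intro tendsto_mult_left lim F)
      ultimately show "ev (c *\<^sub>C x) = c * ev x"
        by (rule LIMSEQ_unique)
      show "cmod (ev x) \<le> norm x * \<bar>C\<bar>"
      proof (rule LIMSEQ_le)
        show "(\<lambda>n. cmod (ev (\<iota> (F n)))) \<longlonglongrightarrow> cmod (ev x)"
          by (intro tendsto_norm lim F)
        show "(\<lambda>n. norm (\<iota> (F n)) * \<bar>C\<bar>) \<longlonglongrightarrow> norm x * \<bar>C\<bar>"
          by (intro tendsto_mult_right tendsto_norm F)
        show "\<exists>N. \<forall>n\<ge>N. cmod (ev (\<iota> (F n))) \<le> norm (\<iota> (F n)) * \<bar>C\<bar>"
          using bound[OF F(1)] by (simp add: ev_\<iota> F(1) mult.commute)
      qed
    qed
    show "ev (act \<phi> x) = \<phi> z * ev x" if \<phi>: "\<phi> \<in> A_alg \<Omega>" for \<phi> x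
    proof -
      obtain F where F: "\<And>n. F n \<in> T" "(\<lambda>n. \<iota> (F n)) \<longlonglongrightarrow> x"
        using approx by blast
      have \<phi>F: "ev (act \<phi> (\<iota> (F n))) = \<phi> z * ev (\<iota> (F n))" for n
      proof -
        have "(\<lambda>z k. \<phi> z * F n z k) \<in> T"
          using F(1) \<open>bounded \<Omega>\<close> \<phi> unfolding T_def by (intro alg_tensor_mult)
        from ev_\<iota>[OF this] show ?thesis
          by (simp add: \<iota>_act \<phi> F(1) ev_\<iota>)
      qed
      have "(\<lambda>n. ev (act \<phi> (\<iota> (F n)))) \<longlonglongrightarrow> ev (act \<phi> x)"
        by (intro lim act_lim \<phi> F)
      moreover have "(\<lambda>n. ev (act \<phi> (\<iota> (F n)))) \<longlonglongrightarrow> \<phi> z * ev x"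
        unfolding \<phi>F by (intro tendsto_mult_left lim F)
      ultimately show ?thesis
        by (rule LIMSEQ_unique)
    qed
    \<comment> \<open>The functional takes the value 1 on the elementary tensor of the unit with
      \<open>\<delta>\<close>; rank at least 1 puts \<open>\<delta>\<close> into
      \<open>ell2 m\<close>.\<close>
    define \<delta> :: "nat \<Rightarrow> complex" where "\<delta> k = (if k = 0 then 1 else 0)" for k
    have "\<not> m \<le> enat 0"
      using m by (metis enat_0 ile0_eq not_one_le_zero zero_enat_def)
    moreover have "summable (\<lambda>k. (cmod (\<delta> k))\<^sup>2)"
      by (rule summable_finite[of "{0}"]) (auto simp: \<delta>_def)
    ultimately have "\<delta> \<in> ell2 m"
      by (auto simp: ell2_def \<delta>_def)
    moreover have "restrict0 \<Omega> (\<lambda>_. 1) \<in> A_alg \<Omega>"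
      by (intro restrict0_in_A_alg holo_on_const) simp
    ultimately have "(\<lambda>z k. restrict0 \<Omega> (\<lambda>_. 1) z * \<delta> k) \<in> T"
      unfolding T_def alg_tensor_def
      by (intro CollectI exI[of _ 1] exI[of _ "\<lambda>_. restrict0 \<Omega> (\<lambda>_. 1)"] exI[of _ "\<lambda>_. \<delta>"]) simp
    from ev_\<iota>[OF this] show "\<exists>x. ev x \<noteq> 0"
      using z by (intro exI[of _ "\<iota> (\<lambda>z k. restrict0 \<Omega> (\<lambda>_. 1) z * \<delta> k)"]) (simp add: \<delta>_def restrict0_def)
  qed
qed

section \<open>Joint eigenvalues\<close>

lemma norm_axis: "norm (axis k a) = norm (a :: 'a::real_normed_vector)"
proof -
  have "(\<Sum>i\<in>UNIV. (norm (vec_nth (axis k a) i))\<^sup>2) = (\<Sum>i\<in>UNIV. if i = k then (norm a)\<^sup>2 else 0)"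
    by (intro sum.cong) (auto simp: axis_def)
  then show ?thesis
    by (simp add: norm_vec_def L2_set_def)
qed

theorem theorem1:
  fixes \<Omega> :: "(complex ^ 'n) set"
    and act :: "(complex ^ 'n \<Rightarrow> complex) \<Rightarrow> 'h \<Rightarrow> 'h::chilbert_space"
  assumes "bounded_domain \<Omega>"
    and "quasi_free \<Omega> act"
    and "\<forall>\<omega>\<in>\<Omega>. semi_fredholm_at \<Omega> act \<omega>"
    and "\<exists>S. pure_isometric_submodule \<Omega> act S \<and> finite_codim S"
  shows "CARD('n) = 1"
proof (rule ccontr)
  have \<Omega>: "open \<Omega>" "\<Omega> \<noteq> {}" "bounded \<Omega>"
    using assms(1) by (auto simp: bounded_domain_def)
  obtain m \<iota> where m: "m \<ge> 1" and M: "hilbert_module \<Omega> act" and qf: "quasi_free_completion \<Omega> act m \<iota>"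
    using assms(2) unfolding quasi_free_def quasi_free_of_rank_def by blast
  obtain U where U: "isometric_module_map \<Omega> act U" and pure: "(\<Inter>k. range (U ^^ k)) = {0}"
    and codim: "finite_codim (range U)"
    using assms(4) unfolding pure_isometric_submodule_def by blast
  interpret pure_isometry U
    using U pure by unfold_locales (auto simp: isometric_module_map_def)
  have U_act: "U (act \<phi> x) = act \<phi> (U x)" if "\<phi> \<in> A_alg \<Omega>" for \<phi> x
    using U that by (simp add: isometric_module_map_def)
  then have U_pow_act: "(U ^^ k) (act \<phi> x) = act \<phi> ((U ^^ k) x)" if "\<phi> \<in> A_alg \<Omega>" for \<phi> x k
    using that by (induction k) auto
  define Z where "Z i = act (restrict0 \<Omega> (\<lambda>z. vec_nth z i))" for i
  have coordinate: "restrict0 \<Omega> (\<lambda>z. vec_nth z i) \<in> A_alg \<Omega>" for i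
    by (intro restrict0_in_A_alg holo_on_coordinate) simp
  obtain d :: nat and b where b: "\<And>l. l < d \<Longrightarrow> norm (b l) = 1"
    and basis: "\<And>v. v \<in> wandering \<Longrightarrow> v = (\<Sum>l<d. cinner v (b l) *\<^sub>C b l)"
    by (rule wandering_basis[OF codim]) (rule that)
  have "\<forall>x. \<exists>h. (\<forall>l<d. h l holomorphic_on ball 0 1) \<and>
    (\<forall>g w. bounded_functional g \<and> (\<forall>x. g (U x) = w * g x) \<and> cmod w < 1 \<longrightarrow>
       g x = (\<Sum>l<d. h l w * g (b l)))"
    by (intro allI holomorphic_symbol b basis)
  then obtain h where h0: "\<forall>x. (\<forall>l<d. h x l holomorphic_on ball 0 1) \<and>
    (\<forall>g w. bounded_functional g \<and> (\<forall>x. g (U x) = w * g x) \<and> cmod w < 1 \<longrightarrow>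
       g x = (\<Sum>l<d. h x l w * g (b l)))"
    by (rule choice[THEN exE])
  have h_holo: "h x l holomorphic_on ball 0 1" if "l < d" for x l
    using h0[THEN spec, THEN conjunct1] that by blast
  have h: "g x = (\<Sum>l<d. h x l w * g (b l))"
    if "bounded_functional g" "\<And>x. g (U x) = w * g x" "cmod w < 1" for x g w
    by (rule h0[THEN spec, THEN conjunct2, THEN spec, THEN spec, THEN mp]) (intro conjI allI that)
  \<comment> \<open>Row \<open>j\<close> holds the coefficients of \<open>Z i (b j)\<close>. With
    this orientation the values of an eigenfunctional on the basis form a right eigenvector.\<close>
  define H where "H i w = mat d d (\<lambda>(j, l). h (Z i (b j)) l w)" for i w
  have H: "H i w \<in> carrier_mat d d" for i w
    by (simp add: H_def)
  \<comment> \<open>A single \<open>w\<close> serves all coordinates, because one functional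
    \<open>g\<close> is an eigenvector for \<open>U\<close> and for every \<open>Z i\<close> at
    once.\<close>
  have eigenvalue: "\<exists>w. cmod w < 1 \<and> (\<forall>i. eigenvalue (H i w) (vec_nth \<omega> i))" if \<omega>: "\<omega> \<in> \<Omega>" for \<omega>
  proof -
    obtain ev where ev: "bounded_functional ev" "\<exists>x. ev x \<noteq> 0"
      and ev_act: "\<And>\<phi> x. \<phi> \<in> A_alg \<Omega> \<Longrightarrow> ev (act \<phi> x) = \<phi> \<omega> * ev x"
      using evaluation_functional[OF M qf m \<Omega>(3) \<omega>] by blast
    define I where "I = ideal_times_module \<Omega> act (max_ideal \<omega>)"
    have "finite_codim I"
      using assms(3) \<omega> by (simp add: semi_fredholm_at_def I_def)
    then obtain B where B: "finite B" "\<And>v. \<exists>b\<in>complex_vector.span B. v - b \<in> I"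
      by (auto simp: finite_codim_def)
    have lin_ev: "bounded_linear ev" and scaleC_ev: "\<And>c x. ev (c *\<^sub>C x) = c * ev x"
      using ev(1) by (auto simp: bounded_functional_def)
    have lin: "bounded_linear (\<lambda>x. ev ((U ^^ k) x))" for k
      using bounded_linear_compose[OF lin_ev bounded_linear_U_pow] .
    \<comment> \<open>\<open>U\<close> commutes with the module action, so \<open>ev\<close>
      composed with a power of \<open>U\<close> still picks up the factor
      \<open>p \<omega> = 0\<close>.\<close>
    have ev_I: "ev ((U ^^ k) v) = 0" if "v \<in> I" for k v
      using that unfolding I_def ideal_times_module_def
    proof (induction v rule: complex_vector.span_induct_alt)
      case base
      show ?case
        by (rule linear_0[OF bounded_linear.linear[OF lin]])
    next
      case (step c x y)
      then obtain p f where p: "x = act (restrict0 \<Omega> p) f" "p \<in> poly_funs" "p \<omega> = 0"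
        by (auto simp: max_ideal_def)
      then have "ev ((U ^^ k) x) = 0"
        using \<omega> by (simp add: U_pow_act ev_act poly_funs_in_A_alg restrict0_apply)
      with step show ?case
        using linear_add[OF bounded_linear.linear[OF lin[of k]], of "c *\<^sub>C x" y]
        by (simp add: U_pow_scaleC scaleC_ev)
    qed
    obtain x0 where "ev x0 \<noteq> 0"
      using ev(2) by blast
    obtain n c w where nz: "\<exists>x. (\<Sum>k\<le>n. c k * ev ((U ^^ k) x)) \<noteq> 0"
      and eig: "\<And>x. (\<Sum>k\<le>n. c k * ev ((U ^^ k) (U x))) = w * (\<Sum>k\<le>(n::nat). c k * ev ((U ^^ k) x))"
      by (rule eigenfunctional_exists[OF ev(1) \<open>ev x0 \<noteq> 0\<close> B ev_I]) (assumption | rule that)+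
    define g where "g x = (\<Sum>k\<le>n. c k * ev ((U ^^ k) x))" for x
    have g: "bounded_functional g"
      unfolding bounded_functional_def g_def
    proof (intro conjI allI)
      show "bounded_linear (\<lambda>x. \<Sum>k\<le>n. c k * ev ((U ^^ k) x))"
        by (intro bounded_linear_sum bounded_linear_const_mult lin)
    qed (simp add: U_pow_scaleC scaleC_ev sum_distrib_left mult_ac)
    have gU: "g (U x) = w * g x" for x
      using eig by (simp add: g_def)
    obtain x1 where x1: "g x1 \<noteq> 0"
      using nz by (auto simp: g_def)
    have w: "cmod w < 1"
      by (rule eigenvalue_in_disc[OF g gU x1])
    \<comment> \<open>The symbol expresses every value of \<open>g\<close> through its values on the
      basis, so these cannot all vanish.\<close>
    have "\<exists>l<d. g (b l) \<noteq> 0"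
      using x1 h[OF g gU w, of x1] by (auto intro: sum.neutral)
    then obtain l where l: "l < d" "g (b l) \<noteq> 0"
      by blast
    have gZ: "g (Z i x) = vec_nth \<omega> i * g x" for i x
      using \<omega> by (simp add: g_def Z_def U_pow_act coordinate ev_act restrict0_apply sum_distrib_left mult_ac)
    have "eigenvalue (H i w) (vec_nth \<omega> i)" for i
      unfolding H_def
      by (rule eigenvalue_matI[where v = "\<lambda>j. g (b j)", OF l]) (simp add: gZ h[OF g gU w, symmetric])
    with w show ?thesis by blast
  qed
  assume "CARD('n) \<noteq> 1"
  then obtain i j :: 'n where "i \<noteq> j"
    by (metis (full_types) UNIV_I card_1_singleton_iff is_singletonI' is_singleton_altdef UNIV_not_empty)
  obtain \<omega> where \<omega>: "\<omega> \<in> \<Omega>"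
    using \<Omega>(2) by blast
  then obtain r where r: "r > 0" "ball \<omega> r \<subseteq> \<Omega>"
    using \<Omega>(1) by (meson openE)
  \<comment> \<open>Two coordinates can be prescribed independently: two shifts, each shorter than
    \<open>r/2\<close>, stay inside the ball of radius \<open>r\<close>.\<close>
  have point: "\<exists>\<zeta>\<in>\<Omega>. vec_nth \<zeta> i = x \<and> vec_nth \<zeta> j = y"
    if "x \<in> ball (vec_nth \<omega> i) (r/2)" "y \<in> ball (vec_nth \<omega> j) (r/2)" for x y
  proof
    define v where "v = axis i (x - vec_nth \<omega> i) + axis j (y - vec_nth \<omega> j)"
    define \<zeta> where "\<zeta> = \<omega> + v"
    show "vec_nth \<zeta> i = x \<and> vec_nth \<zeta> j = y"
      using \<open>i \<noteq> j\<close> by (simp add: \<zeta>_def v_def axis_def)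
    have "norm v \<le> norm (x - vec_nth \<omega> i) + norm (y - vec_nth \<omega> j)"
      unfolding v_def by (metis norm_axis norm_triangle_ineq)
    also have "\<dots> < r"
      using that by (simp add: dist_norm norm_minus_commute)
    finally have "\<zeta> \<in> ball \<omega> r"
      by (simp add: \<zeta>_def dist_norm)
    then show "\<zeta> \<in> \<Omega>"
      using r by blast
  qed
  have "infinite (ball (vec_nth \<omega> i) (r/2))"
    using uncountable_ball[of "r/2" "vec_nth \<omega> i"] r(1) countable_finite by auto
  \<comment> \<open>This choice makes \<open>D 0\<close> nonzero below, so that \<open>D\<close>
    does not vanish identically on the disc.\<close>
  then obtain x where x: "x \<in> ball (vec_nth \<omega> i) (r/2)" "\<not> eigenvalue (H i 0) x"
    using finite_eigenvalues[OF H[of i 0]] by (metis finite_subset mem_Collect_eq subsetI)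
  define D where "D w = Determinant.det (char_matrix (H i w) x)" for w
  have D: "D w = 0 \<longleftrightarrow> eigenvalue (H i w) x" for w
    using eigenvalue_det[OF H] by (simp add: D_def)
  have holo: "D holomorphic_on ball 0 1"
    unfolding D_def H_def using h_holo by (intro holomorphic_on_det_char_matrix) (simp add: eta_contract_eq)
  define W where "W = {w \<in> ball 0 1. D w = 0}"
  have W: "countable W"
  proof (cases "D constant_on ball 0 1")
    case True
    then obtain c where c: "\<And>w. w \<in> ball 0 1 \<Longrightarrow> D w = c"
      by (auto simp: constant_on_def)
    have "c \<noteq> 0"
      using x(2) D[of 0] c[of 0] by auto
    then have "W = {}"
      by (auto simp: W_def c)
    then show ?thesis by simp
  next
    case False
    \<comment> \<open>An exhaustion by compact sets shows that the disc is an F-sigma set, as the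
      theorem on countable zero sets asks.\<close>
    obtain C :: "nat \<Rightarrow> complex set" where "\<And>n. compact (C n)" "\<Union>(range C) = ball 0 1"
      using open_Union_compact_subsets[OF open_ball[of "0::complex" 1]] by metis
    then have "fsigma (ball (0::complex) 1)"
      using fsigma.intros[of C] by (simp add: compact_imp_closed)
    then show ?thesis
      unfolding W_def by (intro holomorphic_countable_zeros holo False) auto
  qed
  \<comment> \<open>With the coordinate \<open>i\<close> frozen at \<open>x\<close>, the parameter
    \<open>w\<close> of each point lies in \<open>W\<close>, so coordinate \<open>j\<close> lies in
    one of countably many finite spectra although it fills an uncountable disc.\<close>
  have "ball (vec_nth \<omega> j) (r/2) \<subseteq> (\<Union>w\<in>W. {y. eigenvalue (H j w) y})"
  proof
    fix y assume "y \<in> ball (vec_nth \<omega> j) (r/2)"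
    then obtain \<zeta> where \<zeta>: "\<zeta> \<in> \<Omega>" "vec_nth \<zeta> i = x" "vec_nth \<zeta> j = y"
      using point x(1) by blast
    then obtain w where "cmod w < 1" "eigenvalue (H i w) x" "eigenvalue (H j w) y"
      using eigenvalue by blast
    then show "y \<in> (\<Union>w\<in>W. {y. eigenvalue (H j w) y})"
      by (auto simp: W_def D)
  qed
  moreover have "countable (\<Union>w\<in>W. {y. eigenvalue (H j w) y})"
    using W finite_eigenvalues[OF H] by (intro countable_UN) (auto intro: countable_finite)
  ultimately show False
    using uncountable_ball[of "r/2" "vec_nth \<omega> j"] r(1) countable_subset by auto
qed

end
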